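(* Assume the Continuum Hypothesis. (1) If $\mathcal{I}$ is an ideal (on a countably infinite set) such that $\mathcal{I}\not\leq_K\mathcal{H}$ (respectively $\mathcal{I}\not\leq_K\mathcal{R}$, respectively $\mathcal{I}\not\leq_K\mathcal{D}$), then there exists an almost disjoint family $\mathcal{A}$ such that the Hausdorff compact and separable space $\Phi(\mathcal{A})$ of cardinality $\mathfrak{c}$ is a Hindman (respectively Ramsey, respectively differentially compact) space that is not in $\mathrm{FinBW}(\mathcal{I})$. (2) There exists an almost disjoint family $\mathcal{A}$ such that the Hausdorff compact and separable space $\Phi(\mathcal{A})$ of cardinality $\mathfrak{c}$ is a Hindman (respectively Ramsey, respectively differentially compact) space that is not an $\mathcal{I}_{1/n}$-space.
   Context: $\omega=\{0,1,2,\dots\}$. An ideal on a countably infinite set $\Lambda$ is a nonempty family $\mathcal{I}\subseteq\mathcal{P}(\Lambda)$ closed under subsets and finite unions, containing all finite subsets of $\Lambda$, with $\Lambda\notin\mathcal{I}$; $\mathcal{I}^+=\mathcal{P}(\Lambda)\setminus\mathcal{I}$. For ideals $\mathcal{I}_i$ on $\Lambda_i$, $\mathcal{I}_2\leq_K\mathcal{I}_1$ (Katětov order) if there is $\phi:\Lambda_1\to\Lambda_2$ with $\phi[A]\notin\mathcal{I}_2$ for each $A\notin\mathcal{I}_1$. For infinite $D\subseteq\omega$: $\mathrm{FS}(D)$ is the set of all sums of nonempty finite sets of distinct elements of $D$; $[D]^2$ is the set of unordered pairs of distinct elements of $D$; $\Delta(D)=\{a-b:a,b\in D,\ a>b\}$.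 The ideals: $\mathcal{H}=\{A\subseteq\omega:\mathrm{FS}(D)\not\subseteq A\text{ for all infinite }D\subseteq\omega\}$ on $\omega$; $\mathcal{R}=\{A\subseteq[\omega]^2:[D]^2\not\subseteq A\text{ for all infinite }D\subseteq\omega\}$ on $[\omega]^2$; $\mathcal{D}=\{A\subseteq\omega:\Delta(D)\not\subseteq A\text{ for all infinite }D\subseteq\omega\}$ on $\omega$; $\mathcal{I}_{1/n}=\{A\subseteq\omega:\sum_{n\in A}\frac1{n+1}<\infty\}$ on $\omega$. A topological space $X$ is a Hindman space if for every $f:\omega\to X$ there are an infinite $D\subseteq\omega$ and $x\in X$ such that for every neighbourhood $U$ of $x$ there is a finite $K\subseteq\omega$ with $f[\mathrm{FS}(D\setminus K)]\subseteq U$. $X$ is a Ramsey space if for every $f:[\omega]^2\to X$ there are an infinite $D\subseteq\omega$ and $x\in X$ such that for every neighbourhood $U$ of $x$ there is a finite $K\subseteq\omega$ with $f[[D\setminus K]^2]\subseteq U$. $X$ is differentially compact if for every $f:\omega\to X$ there are an infinite $D\subseteq\omega$ and $x\in X$ such that for every neighbourhood $U$ of $x$ there is a finite $K\subseteq\omega$ with $f[\Delta(D\setminus K)]\subseteq U$. For an ideal $\mathcal{I}$ on $\Lambda$, $\mathrm{FinBW}(\mathcal{I})$ is the class of all topological spaces $X$ such that for every $f:\Lambda\to X$ there is $A\in\mathcal{I}^+$ such that $f\restriction A$ converges (to some $x\in X$: every neighbourhood of $x$ contains $f(a)$ for all but finitely many $a\in A$). An $\mathcal{I}_{1/n}$-space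 is a member of $\mathrm{FinBW}(\mathcal{I}_{1/n})$. An almost disjoint family on a countably infinite set $\Lambda$ is a family $\mathcal{A}$ of infinite subsets of $\Lambda$ with $A\cap B$ finite for distinct $A,B\in\mathcal{A}$. For infinite such $\mathcal{A}$, $\Psi(\mathcal{A})=\Lambda\cup\mathcal{A}$ is the space in which points of $\Lambda$ are isolated and basic neighbourhoods of $A\in\mathcal{A}$ are $\{A\}\cup(A\setminus F)$ with $F$ finite; $\Phi(\mathcal{A})=\Psi(\mathcal{A})\cup\{\infty\}$ is its Alexandroff one-point compactification. *)

theory Defs
  imports "HOL-Analysis.Analysis" "HOL-Library.Ramsey" "HOL-Library.Equipollence"
begin

definition continuum_hypothesis :: bool where
  "continuum_hypothesis \<longleftrightarrow>
     (\<forall>S :: real set. infinite S \<longrightarrow> countable S \<or> S \<approx> (UNIV :: real set))"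

definition ideal_on :: "'a set \<Rightarrow> 'a set set \<Rightarrow> bool" where
  "ideal_on \<Lambda> \<I> \<longleftrightarrow>
     \<I> \<noteq> {} \<and> \<I> \<subseteq> Pow \<Lambda> \<and>
     (\<forall>A\<in>\<I>. \<forall>B. B \<subseteq> A \<longrightarrow> B \<in> \<I>) \<and>
     (\<forall>A\<in>\<I>. \<forall>B\<in>\<I>. A \<union> B \<in> \<I>) \<and>
     (\<forall>F. finite F \<and> F \<subseteq> \<Lambda> \<longrightarrow> F \<in> \<I>) \<and>
     \<Lambda> \<notin> \<I>"

definition positive_sets :: "'a set \<Rightarrow> 'a set set \<Rightarrow> 'a set set" where
  "positive_sets \<Lambda> \<I> = Pow \<Lambda> - \<I>"

text \<open>\<open>katetov_le \<Lambda>2 \<I>2 \<Lambda>1 \<I>1\<close> says that \<open>\<I>2\<close> (on \<open>\<Lambda>2\<close>) is Katetov below \<open>\<I>1\<close> (on \<open>\<Lambda>1\<close>).\<close>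

definition katetov_le :: "'b set \<Rightarrow> 'b set set \<Rightarrow> 'a set \<Rightarrow> 'a set set \<Rightarrow> bool" where
  "katetov_le \<Lambda>2 \<I>2 \<Lambda>1 \<I>1 \<longleftrightarrow>
     (\<exists>\<phi>. \<phi> \<in> \<Lambda>1 \<rightarrow> \<Lambda>2 \<and> (\<forall>A. A \<subseteq> \<Lambda>1 \<and> A \<notin> \<I>1 \<longrightarrow> \<phi> ` A \<notin> \<I>2))"

definition FS :: "nat set \<Rightarrow> nat set" where
  "FS D = {\<Sum>F | F. finite F \<and> F \<noteq> {} \<and> F \<subseteq> D}"

definition Delta :: "nat set \<Rightarrow> nat set" where
  "Delta D = {a - b | a b. a \<in> D \<and> b \<in> D \<and> a > b}"

definition Hindman_ideal :: "nat set set" where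
  "Hindman_ideal = {A. \<forall>D. infinite D \<longrightarrow> \<not> FS D \<subseteq> A}"

definition Ramsey_ideal :: "nat set set set" where
  "Ramsey_ideal = {A. A \<subseteq> [UNIV]\<^bsup>2\<^esup> \<and> (\<forall>D. infinite D \<longrightarrow> \<not> [D]\<^bsup>2\<^esup> \<subseteq> A)}"

definition Delta_ideal :: "nat set set" where
  "Delta_ideal = {A. \<forall>D. infinite D \<longrightarrow> \<not> Delta D \<subseteq> A}"

definition summable_ideal :: "nat set set" where
  "summable_ideal = {A. (\<lambda>n. 1 / (real n + 1)) summable_on A}"

definition Hindman_space :: "'x topology \<Rightarrow> bool" where
  "Hindman_space X \<longleftrightarrow>
     (\<forall>f. f \<in> UNIV \<rightarrow> topspace X \<longrightarrow>
       (\<exists>D x. infinite D \<and> x \<in> topspace X \<and>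
         (\<forall>U. openin X U \<and> x \<in> U \<longrightarrow> (\<exists>K. finite K \<and> f ` FS (D - K) \<subseteq> U))))"

definition Ramsey_space :: "'x topology \<Rightarrow> bool" where
  "Ramsey_space X \<longleftrightarrow>
     (\<forall>f. f \<in> [UNIV :: nat set]\<^bsup>2\<^esup> \<rightarrow> topspace X \<longrightarrow>
       (\<exists>D x. infinite D \<and> x \<in> topspace X \<and>
         (\<forall>U. openin X U \<and> x \<in> U \<longrightarrow> (\<exists>K. finite K \<and> f ` [D - K]\<^bsup>2\<^esup> \<subseteq> U))))"

definition differentially_compact_space :: "'x topology \<Rightarrow> bool" where
  "differentially_compact_space X \<longleftrightarrow>
     (\<forall>f. f \<in> UNIV \<rightarrow> topspace X \<longrightarrow>
       (\<exists>D x. infinite D \<and> x \<in> topspace X \<and>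
         (\<forall>U. openin X U \<and> x \<in> U \<longrightarrow> (\<exists>K. finite K \<and> f ` Delta (D - K) \<subseteq> U))))"

definition FinBW :: "'a set \<Rightarrow> 'a set set \<Rightarrow> 'x topology set" where
  "FinBW \<Lambda> \<I> =
     {X. \<forall>f. f \<in> \<Lambda> \<rightarrow> topspace X \<longrightarrow>
       (\<exists>A\<in>positive_sets \<Lambda> \<I>. \<exists>x\<in>topspace X.
         \<forall>U. openin X U \<and> x \<in> U \<longrightarrow> finite {a \<in> A. f a \<notin> U})}"

definition almost_disjoint_family :: "'a set \<Rightarrow> 'a set set \<Rightarrow> bool" where
  "almost_disjoint_family \<Lambda> \<A> \<longleftrightarrow>
     (\<forall>A\<in>\<A>. A \<subseteq> \<Lambda> \<and> infinite A) \<and>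
     (\<forall>A\<in>\<A>. \<forall>B\<in>\<A>. A \<noteq> B \<longrightarrow> finite (A \<inter> B))"

text \<open>The underlying set \<open>\<Lambda> \<union> \<A>\<close> is a disjoint union, hence the sum type. A set is open iff it
  contains a basic neighbourhood of each of its points; for the isolated points of \<open>\<Lambda>\<close> this is
  no condition.\<close>

definition Psi :: "'a set \<Rightarrow> 'a set set \<Rightarrow> ('a + 'a set) topology" where
  "Psi \<Lambda> \<A> = topology (\<lambda>U. U \<subseteq> Inl ` \<Lambda> \<union> Inr ` \<A> \<and>
     (\<forall>A\<in>\<A>. Inr A \<in> U \<longrightarrow> (\<exists>F. finite F \<and> insert (Inr A) (Inl ` (A - F)) \<subseteq> U)))"

lemma openin_Psi:
  "openin (Psi \<Lambda> \<A>) U \<longleftrightarrow> U \<subseteq> Inl ` \<Lambda> \<union> Inr ` \<A> \<and>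
     (\<forall>A\<in>\<A>. Inr A \<in> U \<longrightarrow> (\<exists>F. finite F \<and> insert (Inr A) (Inl ` (A - F)) \<subseteq> U))"
proof -
  let ?P = "\<lambda>U. U \<subseteq> Inl ` \<Lambda> \<union> Inr ` \<A> \<and>
     (\<forall>A\<in>\<A>. Inr A \<in> U \<longrightarrow> (\<exists>F. finite F \<and> insert (Inr A) (Inl ` (A - F)) \<subseteq> U))"
  have 1: "?P (S \<inter> T)" if S: "?P S" and T: "?P T" for S T
  proof (intro conjI ballI impI)
    show "S \<inter> T \<subseteq> Inl ` \<Lambda> \<union> Inr ` \<A>" using S by blast
  next
    fix A assume A: "A \<in> \<A>" "Inr A \<in> S \<inter> T"
    obtain F where F: "finite F" "insert (Inr A) (Inl ` (A - F)) \<subseteq> S" using S A by blast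
    obtain G where G: "finite G" "insert (Inr A) (Inl ` (A - G)) \<subseteq> T" using T A by blast
    have "finite (F \<union> G) \<and> insert (Inr A) (Inl ` (A - (F \<union> G))) \<subseteq> S \<inter> T"
      using F G by blast
    then show "\<exists>F. finite F \<and> insert (Inr A) (Inl ` (A - F)) \<subseteq> S \<inter> T" by blast
  qed
  have 2: "?P (\<Union>\<K>)" if K: "\<forall>K\<in>\<K>. ?P K" for \<K>
  proof (intro conjI ballI impI)
    show "\<Union>\<K> \<subseteq> Inl ` \<Lambda> \<union> Inr ` \<A>" using K by blast
  next
    fix A assume A: "A \<in> \<A>" "Inr A \<in> \<Union>\<K>"
    then obtain K where "K \<in> \<K>" "Inr A \<in> K" by blast
    moreover from this obtain F where "finite F" "insert (Inr A) (Inl ` (A - F)) \<subseteq> K"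
      using K A(1) by meson
    ultimately show "\<exists>F. finite F \<and> insert (Inr A) (Inl ` (A - F)) \<subseteq> \<Union>\<K>" by blast
  qed
  have "istopology ?P"
    unfolding istopology_def using 1 2 by blast
  then show ?thesis by (simp add: Psi_def topology_inverse')
qed

lemma topspace_Psi:
  assumes "almost_disjoint_family \<Lambda> \<A>"
  shows "topspace (Psi \<Lambda> \<A>) = Inl ` \<Lambda> \<union> Inr ` \<A>"
proof
  show "topspace (Psi \<Lambda> \<A>) \<subseteq> Inl ` \<Lambda> \<union> Inr ` \<A>"
    using openin_topspace[of "Psi \<Lambda> \<A>"] by (simp only: openin_Psi)
  have "insert (Inr A) (Inl ` (A - {})) \<subseteq> Inl ` \<Lambda> \<union> Inr ` \<A>" if "A \<in> \<A>" for A
    using assms that by (auto simp: almost_disjoint_family_def)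
  then have "openin (Psi \<Lambda> \<A>) (Inl ` \<Lambda> \<union> Inr ` \<A>)"
    unfolding openin_Psi by (meson finite.emptyI subset_refl)
  then show "Inl ` \<Lambda> \<union> Inr ` \<A> \<subseteq> topspace (Psi \<Lambda> \<A>)"
    by (rule openin_subset)
qed

definition Phi :: "'a set \<Rightarrow> 'a set set \<Rightarrow> ('a + 'a set) option topology" where
  "Phi \<Lambda> \<A> = Alexandroff_compactification (Psi \<Lambda> \<A>)"

end

theory Submission
  imports Defs
begin

text \<open>
  Write \<open>\<rho>\<close> for each of \<open>D \<mapsto> FS D\<close>, \<open>D \<mapsto> [D]\<^sup>2\<close> and \<open>D \<mapsto> Delta D\<close>. The only combinatorial input is
  that countably many sets can be decided simultaneously along the tails \<open>\<rho> (E - K)\<close>, \<open>K\<close> finite, of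
  a suitable \<open>E\<close> with \<open>\<rho> E \<subseteq> \<rho> D\<close>; for \<open>FS\<close> this is Hindman's theorem in its idempotent ultrafilter
  form.

  Under CH let the triples \<open>(f, D, B)\<close> with \<open>f ` \<rho> D \<in> \<I>\<close> and \<open>B \<notin> \<I>\<close> be listed in a well-order with
  countable initial segments. At stage \<open>a\<close> choose \<open>E\<close> with \<open>\<rho> E \<subseteq> \<rho> D\<close> along which \<open>f\<close> is eventually
  constant or tends to infinity, and along which the preimages of all earlier members of the family
  are decided. Then choose the new member \<open>A \<subseteq> B\<close> in \<open>\<I>\<close>, almost disjoint from the earlier members
  and from all the sets \<open>f ` \<rho> E\<close> met so far; this is possible because these countably many sets
  lie in \<open>\<I>\<close> while \<open>B\<close> does not. Consequently \<open>f\<close> converges along \<open>E\<close>, either to an earlier member or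
  to the point at infinity, since every later member is almost disjoint from \<open>f ` \<rho> E\<close>. As every
  positive set contains a member of the family and all members lie in \<open>\<I>\<close>, the inclusion of the
  isolated points shows that the space is not in \<open>FinBW\<close>.

  For the summable ideal, thin out \<open>E\<close> so fast that every new value is either one of the old limits
  or very large.
\<close>

section \<open>Deciding countably many sets along tails\<close>

text \<open>As a filter, the convergence required in Hindman, Ramsey and differentially compact
  spaces becomes plain eventuality. The family is a filter once \<open>\<rho>\<close> is monotone,
  because the removed finite sets can be united.\<close>

definition tail_filter :: "(nat set \<Rightarrow> 'l set) \<Rightarrow> nat set \<Rightarrow> 'l filter" where
  "tail_filter \<rho> D = Abs_filter (\<lambda>P. \<exists>K. finite K \<and> (\<forall>x\<in>\<rho> (D - K). P x))"

lemma eventually_tail_filter: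
  assumes "mono \<rho>"
  shows "eventually P (tail_filter \<rho> D) \<longleftrightarrow> (\<exists>K. finite K \<and> (\<forall>x\<in>\<rho> (D - K). P x))"
proof -
  have "is_filter (\<lambda>P. \<exists>K. finite K \<and> (\<forall>x\<in>\<rho> (D - K). P x))"
  proof
    fix P Q assume "\<exists>K. finite K \<and> (\<forall>x\<in>\<rho> (D - K). P x)" "\<exists>K. finite K \<and> (\<forall>x\<in>\<rho> (D - K). Q x)"
    then obtain K L where "finite K" "finite L" "\<forall>x\<in>\<rho> (D - K). P x" "\<forall>x\<in>\<rho> (D - L). Q x" by blast
    moreover have "\<rho> (D - (K \<union> L)) \<subseteq> \<rho> (D - K)" "\<rho> (D - (K \<union> L)) \<subseteq> \<rho> (D - L)"
      by (intro monoD[OF assms]; blast)+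
    ultimately show "\<exists>K. finite K \<and> (\<forall>x\<in>\<rho> (D - K). P x \<and> Q x)"
      by (intro exI[of _ "K \<union> L"]) auto
  qed blast+
  then show ?thesis by (simp add: tail_filter_def eventually_Abs_filter)
qed

lemma tail_filter_neq_bot:
  assumes "mono \<rho>" "\<And>D. infinite D \<Longrightarrow> \<rho> D \<noteq> {}" "infinite D"
  shows "tail_filter \<rho> D \<noteq> bot"
proof
  assume "tail_filter \<rho> D = bot"
  then have "eventually (\<lambda>_. False) (tail_filter \<rho> D)" by simp
  then obtain K where "finite K" "\<rho> (D - K) = {}"
    unfolding eventually_tail_filter[OF assms(1)] by blast
  then show False using assms(2)[of "D - K"] assms(3) by simp
qed

text \<open>Only \<open>\<rho> E \<subseteq> \<rho> D\<close> is asked, not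
  \<open>E \<subseteq> D\<close>: for \<open>FS\<close> the points of \<open>E\<close> are sums of
  points of \<open>D\<close>. Each \<open>S n\<close> may cost its own finite part of
  \<open>E\<close>, which is what lets infinitely many sets be decided at once.\<close>

definition diagonally_Ramsey :: "(nat set \<Rightarrow> 'l set) \<Rightarrow> bool" where
  "diagonally_Ramsey \<rho> \<longleftrightarrow> mono \<rho> \<and>
     (\<forall>D (S :: nat \<Rightarrow> 'l set). infinite D \<longrightarrow> (\<exists>E. infinite E \<and> \<rho> E \<subseteq> \<rho> D \<and>
       (\<forall>n. (\<forall>\<^sub>F y in tail_filter \<rho> E. y \<in> S n) \<or> (\<forall>\<^sub>F y in tail_filter \<rho> E. y \<notin> S n))))"

lemma diagonally_Ramsey_decide:
  assumes "diagonally_Ramsey \<rho>" "infinite D" "countable \<S>"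
  obtains E where "infinite E" "\<rho> E \<subseteq> \<rho> D"
    "\<And>S. S \<in> \<S> \<Longrightarrow> (\<forall>\<^sub>F y in tail_filter \<rho> E. y \<in> S) \<or> (\<forall>\<^sub>F y in tail_filter \<rho> E. y \<notin> S)"
proof -
  obtain E where E: "infinite E" "\<rho> E \<subseteq> \<rho> D"
    "\<And>n. (\<forall>\<^sub>F y in tail_filter \<rho> E. y \<in> from_nat_into \<S> n) \<or> (\<forall>\<^sub>F y in tail_filter \<rho> E. y \<notin> from_nat_into \<S> n)"
    using assms(1,2) unfolding diagonally_Ramsey_def by metis
  have "(\<forall>\<^sub>F y in tail_filter \<rho> E. y \<in> S) \<or> (\<forall>\<^sub>F y in tail_filter \<rho> E. y \<notin> S)" if "S \<in> \<S>" for S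
    using E(3)[of "to_nat_on \<S> S"] from_nat_into_to_nat_on[OF assms(3) that] by simp
  then show ?thesis using that E(1,2) by blast
qed

text \<open>Common source of the unordered pairs and of the differences: both are images of the
  increasing pairs, and images inherit \<open>diagonally_Ramsey\<close>.\<close>

definition ordered_pairs :: "nat set \<Rightarrow> (nat \<times> nat) set" where
  "ordered_pairs D = {(a, b). a \<in> D \<and> b \<in> D \<and> a < b}"

lemma mono_ordered_pairs: "mono ordered_pairs"
  by (auto simp: mono_def ordered_pairs_def)

lemma ordered_pairs_row:
  assumes "infinite D" "a \<in> D"
  shows "infinite {b. (a, b) \<in> ordered_pairs D}"
proof -
  have "infinite (D - {..a})" using assms by simp
  moreover have "D - {..a} \<subseteq> {b. (a, b) \<in> ordered_pairs D}"
    using assms by (auto simp: ordered_pairs_def)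
  ultimately show ?thesis by (rule infinite_super[rotated])
qed

lemma ordered_pairs_nonempty:
  assumes "infinite D"
  shows "ordered_pairs D \<noteq> {}"
proof -
  obtain a where "a \<in> D" using assms by fastforce
  then show ?thesis using ordered_pairs_row[OF assms] by force
qed

lemma Ramsey_ordered_pairs:
  assumes "infinite D"
  obtains E where "E \<subseteq> D" "infinite E" "ordered_pairs E \<subseteq> S \<or> ordered_pairs E \<inter> S = {}"
proof -
  \<comment> \<open>\<open>Ramsey2\<close> colours unordered pairs, so the increasing pair is
    recovered as minimum and maximum.\<close>
  define c where "c X = (if (Min X, Max X) \<in> S then 0 else 1 :: nat)" for X
  have "\<exists>E t. E \<subseteq> D \<and> infinite E \<and> t < 2 \<and> (\<forall>x\<in>E. \<forall>y\<in>E. x \<noteq> y \<longrightarrow> c {x, y} = t)"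
    using assms by (intro Ramsey2) (auto simp: c_def)
  then obtain E t where E: "E \<subseteq> D" "infinite E" "\<forall>x\<in>E. \<forall>y\<in>E. x \<noteq> y \<longrightarrow> c {x, y} = t"
    by (elim exE conjE)
  have "c {a, b} = t \<and> c {a, b} = (if (a, b) \<in> S then 0 else 1)" if "(a, b) \<in> ordered_pairs E" for a b
    using that E(3)[rule_format, of a b] by (simp add: c_def ordered_pairs_def min_def max_def)
  then have "(a, b) \<in> S \<longleftrightarrow> t = 0" if "(a, b) \<in> ordered_pairs E" for a b
    using that by (metis zero_neq_one)
  then have "ordered_pairs E \<subseteq> S \<or> ordered_pairs E \<inter> S = {}"
    by (cases "t = 0") auto
  then show ?thesis using that E by blast
qed

text \<open>A decreasing sequence of sets homogeneous for \<open>S 0\<close>, \<open>S 1\<close>,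
  and so on is diagonalised: one point is taken from each, and once the first \<open>n\<close>
  points are dropped the rest lies in the set chosen for \<open>S n\<close>.\<close>

lemma diagonally_Ramsey_ordered_pairs: "diagonally_Ramsey ordered_pairs"
  unfolding diagonally_Ramsey_def
proof (intro conjI allI impI mono_ordered_pairs)
  fix D :: "nat set" and S :: "nat \<Rightarrow> (nat \<times> nat) set"
  assume D: "infinite D"
  let ?hom = "\<lambda>n Y. ordered_pairs Y \<subseteq> S n \<or> ordered_pairs Y \<inter> S n = {}"
  \<comment> \<open>\<open>h n\<close> pairs the set homogeneous for \<open>S n\<close> with the
    point taken from it.\<close>
  have "\<exists>h. \<forall>n. (infinite (fst (h n)) \<and> fst (h n) \<subseteq> D \<and> ?hom n (fst (h n)) \<and> snd (h n) \<in> fst (h n)) \<and>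
     (fst (h (Suc n)) \<subseteq> fst (h n) \<and> snd (h n) < snd (h (Suc n)))"
  proof (rule dependent_nat_choice[where
        P = "\<lambda>n z. infinite (fst z) \<and> fst z \<subseteq> D \<and> ?hom n (fst z) \<and> snd z \<in> fst z" and
        Q = "\<lambda>n z z'. fst z' \<subseteq> fst z \<and> snd z < snd z'"])
    obtain Y where "Y \<subseteq> D" "infinite Y" "?hom 0 Y" using Ramsey_ordered_pairs[OF D] by metis
    moreover from this obtain x where "x \<in> Y" by fastforce
    ultimately show "\<exists>z. infinite (fst z) \<and> fst z \<subseteq> D \<and> ?hom 0 (fst z) \<and> snd z \<in> fst z"
      by (intro exI[of _ "(Y, x)"]) simp
  next
    fix z n assume z: "infinite (fst z) \<and> fst z \<subseteq> D \<and> ?hom n (fst z) \<and> snd z \<in> fst z"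
    obtain Y where Y: "Y \<subseteq> fst z" "infinite Y" "?hom (Suc n) Y"
      using Ramsey_ordered_pairs[OF conjunct1[OF z]] by metis
    obtain x where "x \<in> Y" "snd z < x" using Y(2) unfolding infinite_nat_iff_unbounded by blast
    then show "\<exists>z'. (infinite (fst z') \<and> fst z' \<subseteq> D \<and> ?hom (Suc n) (fst z') \<and> snd z' \<in> fst z') \<and>
        (fst z' \<subseteq> fst z \<and> snd z < snd z')"
      using Y z by (intro exI[of _ "(Y, x)"]) auto
  qed
  then obtain h where h: "\<And>n. fst (h n) \<subseteq> D" "\<And>n. ?hom n (fst (h n))" "\<And>n. snd (h n) \<in> fst (h n)"
    "\<And>n. fst (h (Suc n)) \<subseteq> fst (h n)" "\<And>n. snd (h n) < snd (h (Suc n))" by blast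
  define x where "x n = snd (h n)" for n
  have "strict_mono x" by (simp add: strict_mono_Suc_iff x_def h)
  then have inf: "infinite (range x)"
    using strict_mono_imp_inj_on range_inj_infinite by blast
  have anti: "fst (h m) \<subseteq> fst (h n)" if "n \<le> m" for n m
    using that by (induction rule: dec_induct) (use h(4) in auto)
  have tail: "range x - x ` {..<n} \<subseteq> fst (h n)" for n
  proof
    fix y assume "y \<in> range x - x ` {..<n}"
    then obtain m where m: "y = x m" "m \<notin> {..<n}" by blast
    then have "fst (h m) \<subseteq> fst (h n)" by (intro anti) simp
    then show "y \<in> fst (h n)" using h(3)[of m] m(1) by (auto simp: x_def)
  qed
  show "\<exists>E. infinite E \<and> ordered_pairs E \<subseteq> ordered_pairs D \<and>
      (\<forall>n. (\<forall>\<^sub>F y in tail_filter ordered_pairs E. y \<in> S n) \<or>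
           (\<forall>\<^sub>F y in tail_filter ordered_pairs E. y \<notin> S n))"
  proof (rule exI[of _ "range x"], intro conjI allI inf)
    show "ordered_pairs (range x) \<subseteq> ordered_pairs D"
      using tail[of 0] h(1)[of 0] by (intro monoD[OF mono_ordered_pairs]) auto
    fix n
    have "ordered_pairs (range x - x ` {..<n}) \<subseteq> ordered_pairs (fst (h n))"
      by (intro monoD[OF mono_ordered_pairs] tail)
    moreover have "finite (x ` {..<n})" by simp
    ultimately show "(\<forall>\<^sub>F y in tail_filter ordered_pairs (range x). y \<in> S n) \<or>
           (\<forall>\<^sub>F y in tail_filter ordered_pairs (range x). y \<notin> S n)"
      unfolding eventually_tail_filter[OF mono_ordered_pairs] using h(2)[of n] by blast
  qed
qed

lemma mono_image: "mono \<rho> \<Longrightarrow> mono (\<lambda>D. e ` \<rho> D)"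
  by (simp add: mono_def image_mono)

lemma eventually_tail_filter_image:
  assumes "mono \<rho>"
  shows "eventually P (tail_filter (\<lambda>D. e ` \<rho> D) E) \<longleftrightarrow> (\<forall>\<^sub>F y in tail_filter \<rho> E. P (e y))"
  by (simp add: eventually_tail_filter[OF assms] eventually_tail_filter[OF mono_image[OF assms]])

text \<open>Deciding \<open>S n\<close> along the image amounts to deciding its preimage under
  \<open>e\<close>.\<close>

lemma diagonally_Ramsey_image:
  assumes "diagonally_Ramsey \<rho>"
  shows "diagonally_Ramsey (\<lambda>D. e ` \<rho> D)"
proof -
  have m: "mono \<rho>" using assms by (simp add: diagonally_Ramsey_def)
  show ?thesis
    unfolding diagonally_Ramsey_def
  proof (intro conjI allI impI mono_image m)
    fix D :: "nat set" and S :: "nat \<Rightarrow> 'b set" assume "infinite D"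
    then obtain E where E: "infinite E" "\<rho> E \<subseteq> \<rho> D"
      "\<And>n. (\<forall>\<^sub>F y in tail_filter \<rho> E. y \<in> e -` S n) \<or> (\<forall>\<^sub>F y in tail_filter \<rho> E. y \<notin> e -` S n)"
      using assms[unfolded diagonally_Ramsey_def, THEN conjunct2, rule_format, of D "\<lambda>n. e -` S n"]
      by blast
    then show "\<exists>E. infinite E \<and> e ` \<rho> E \<subseteq> e ` \<rho> D \<and>
        (\<forall>n. (\<forall>\<^sub>F y in tail_filter (\<lambda>D. e ` \<rho> D) E. y \<in> S n) \<or>
             (\<forall>\<^sub>F y in tail_filter (\<lambda>D. e ` \<rho> D) E. y \<notin> S n))"
      unfolding eventually_tail_filter_image[OF m] by (intro exI[of _ E]) auto
  qed
qed

section \<open>Finite sums and idempotent ultrafilters\<close>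

text \<open>Zorn's lemma in the downward direction, towards finer filters. The empty chain is
  bounded by \<open>F0\<close> itself.\<close>

lemma filter_Zorn:
  assumes "Q F0"
    and chain: "\<And>C. C \<noteq> {} \<Longrightarrow> (\<And>F. F \<in> C \<Longrightarrow> Q F) \<Longrightarrow>
      (\<And>F G. F \<in> C \<Longrightarrow> G \<in> C \<Longrightarrow> F \<le> G \<or> G \<le> F) \<Longrightarrow> Q (Inf C)"
  obtains F :: "'a filter" where "F \<le> F0" "Q F" "\<And>G. Q G \<Longrightarrow> G \<le> F \<Longrightarrow> G = F"
proof -
  define A where "A = {F. Q F \<and> F \<le> F0}"
  have "\<exists>m\<in>A. \<forall>a\<in>A. a \<le> m \<longrightarrow> a = m"
  proof (rule predicate_Zorn)
    show "partial_order_on A (relation_of (\<lambda>x y. y \<le> x) A)"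
      by (auto simp: partial_order_on_def preorder_on_def refl_on_def trans_def antisym_def
          relation_of_def)
    fix C assume C: "C \<in> Chains (relation_of (\<lambda>x y. y \<le> x) A)"
    show "\<exists>u\<in>A. \<forall>a\<in>C. u \<le> a"
    proof (cases "C = {}")
      case True
      then show ?thesis using assms(1) by (auto simp: A_def)
    next
      case False
      have CA: "C \<subseteq> A" and lin: "F \<le> G \<or> G \<le> F" if "F \<in> C" "G \<in> C" for F G
        using C that by (auto simp: Chains_def relation_of_def)
      then have "C \<subseteq> A" using False by blast
      have "Q (Inf C)"
        using False \<open>C \<subseteq> A\<close> lin by (intro chain) (auto simp: A_def)
      moreover have "Inf C \<le> F0"
        using False \<open>C \<subseteq> A\<close> unfolding A_def by (metis (no_types, lifting) Inf_lower2 all_not_in_conv mem_Collect_eq subsetD)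
      ultimately show ?thesis by (auto simp: A_def intro: Inf_lower)
    qed
  qed
  then obtain m where m: "m \<in> A" "\<And>a. a \<in> A \<Longrightarrow> a \<le> m \<Longrightarrow> a = m" by blast
  show ?thesis
    by (rule that[of m]) (use m in \<open>auto simp: A_def intro: order_trans\<close>)
qed

text \<open>A chain is directed, so no finite meets have to be formed: the infimum is the union of
  the families of eventual properties.\<close>

lemma eventually_Inf_chain:
  assumes "C \<noteq> {}" "\<And>F G. F \<in> C \<Longrightarrow> G \<in> C \<Longrightarrow> F \<le> G \<or> G \<le> F"
  shows "eventually P (Inf C) \<longleftrightarrow> (\<exists>F\<in>C. eventually P F)"
  using assms by (intro eventually_Inf_base) (metis inf.absorb_iff2 inf.absorb_iff1 order_refl)+

text \<open>A minimal proper filter decides every \<open>P\<close>: meeting it with \<open>P\<close>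
  gives either the improper filter or the same filter again.\<close>

lemma ultrafilter_exists:
  assumes "F \<noteq> (bot :: 'a filter)"
  obtains p where "p \<le> F" "p \<noteq> bot" "\<And>P. eventually P p \<or> eventually (\<lambda>x. \<not> P x) p"
proof -
  obtain p where p: "p \<le> F" "p \<noteq> bot" "\<And>G. G \<noteq> bot \<Longrightarrow> G \<le> p \<Longrightarrow> G = p"
  proof (rule filter_Zorn[of "\<lambda>F. F \<noteq> bot" F])
    show "Inf C \<noteq> bot" if "C \<noteq> {}" "\<And>F. F \<in> C \<Longrightarrow> F \<noteq> bot"
      "\<And>F G. F \<in> C \<Longrightarrow> G \<in> C \<Longrightarrow> F \<le> G \<or> G \<le> F" for C :: "'a filter set"
      using eventually_Inf_chain[OF that(1,3), of "\<lambda>_. False"] that(2)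
      by (auto simp: trivial_limit_def)
  qed (use assms in auto)
  have "eventually P p \<or> eventually (\<lambda>x. \<not> P x) p" for P
  proof (cases "inf p (principal {x. P x}) = bot")
    case True
    then have "eventually (\<lambda>_. False) (inf p (principal {x. P x}))" by simp
    then show ?thesis by (simp add: eventually_inf_principal)
  next
    case False
    then have "inf p (principal {x. P x}) = p" by (intro p(3)) auto
    moreover have "eventually P (inf p (principal {x. P x}))" by (simp add: eventually_inf_principal)
    ultimately show ?thesis by simp
  qed
  then show ?thesis using that p by blast
qed

text \<open>The condition is \<open>F + F \<le> F\<close> for the convolution of filters; for a
  proper ultrafilter it becomes an equality.\<close>

definition idempotent_filter :: "'a::semigroup_add filter \<Rightarrow> bool" where
  "idempotent_filter F \<longleftrightarrow> (\<forall>P. eventually P F \<longrightarrow> (\<forall>\<^sub>F x in F. \<forall>\<^sub>F y in F. P (x + y)))"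

lemma idempotent_filterD:
  "idempotent_filter F \<Longrightarrow> eventually P F \<Longrightarrow> \<forall>\<^sub>F x in F. \<forall>\<^sub>F y in F. P (x + y)"
  by (simp add: idempotent_filter_def)

text \<open>Papazyan's form of the Ellis--Numakura lemma: a proper idempotent filter that is minimal in the
  order of filters is already an ultrafilter, so Zorn's lemma applies directly to filters.\<close>

lemma idempotent_ultrafilter_exists:
  fixes F0 :: "'a::semigroup_add filter"
  assumes "F0 \<noteq> bot" "idempotent_filter F0"
  obtains p where "p \<le> F0" "p \<noteq> bot" "idempotent_filter p"
    "\<And>P. eventually P p \<or> eventually (\<lambda>x. \<not> P x) p"
proof -
  obtain F where F: "F \<le> F0" "F \<noteq> bot \<and> idempotent_filter F"
    and minimal: "\<And>G. G \<noteq> bot \<and> idempotent_filter G \<Longrightarrow> G \<le> F \<Longrightarrow> G = F"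
  proof (rule filter_Zorn[of "\<lambda>F. F \<noteq> bot \<and> idempotent_filter F" F0])
    fix C :: "'a filter set"
    assume C: "C \<noteq> {}" "\<And>F. F \<in> C \<Longrightarrow> F \<noteq> bot \<and> idempotent_filter F"
      "\<And>F G. F \<in> C \<Longrightarrow> G \<in> C \<Longrightarrow> F \<le> G \<or> G \<le> F"
    note ev = eventually_Inf_chain[OF C(1,3)]
    have "Inf C \<noteq> bot"
      using ev[of "\<lambda>_. False"] C(2) by (auto simp: trivial_limit_def)
    moreover have "idempotent_filter (Inf C)"
      unfolding idempotent_filter_def
    proof (intro allI impI)
      fix P assume "eventually P (Inf C)"
      then obtain F where F: "F \<in> C" "eventually P F" using ev by blast
      then have "\<forall>\<^sub>F x in F. \<forall>\<^sub>F y in F. P (x + y)" using C(2) idempotent_filterD by blast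
      then have "\<forall>\<^sub>F x in F. \<forall>\<^sub>F y in Inf C. P (x + y)"
        by (rule eventually_mono) (use F ev in blast)
      then show "\<forall>\<^sub>F x in Inf C. \<forall>\<^sub>F y in Inf C. P (x + y)" using F ev by blast
    qed
    ultimately show "Inf C \<noteq> bot \<and> idempotent_filter (Inf C)" ..
  qed (use assms in auto)
  obtain p where p: "p \<le> F" "p \<noteq> bot" "\<And>P. eventually P p \<or> eventually (\<lambda>x. \<not> P x) p"
    using ultrafilter_exists F(2) by blast
  have pF: "eventually P p" if "eventually P F" for P
    using that p(1) by (rule filter_leD[rotated])
  note idem = idempotent_filterD[OF conjunct2[OF F(2)]]
  \<comment> \<open>\<open>G\<close> is the convolution \<open>F + p\<close>. It lies below
    \<open>F\<close>, since \<open>p \<le> F\<close> and \<open>F\<close> is idempotent, and it is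
    idempotent itself, so minimality gives \<open>F + p = F\<close>.\<close>
  define G where "G = Abs_filter (\<lambda>P. \<forall>\<^sub>F x in F. \<forall>\<^sub>F y in p. P (x + y))"
  have "is_filter (\<lambda>P. \<forall>\<^sub>F x in F. \<forall>\<^sub>F y in p. P (x + y))"
    by unfold_locales (auto simp: eventually_conj_iff elim!: eventually_mono)
  then have G: "eventually P G \<longleftrightarrow> (\<forall>\<^sub>F x in F. \<forall>\<^sub>F y in p. P (x + y))" for P
    by (simp add: G_def eventually_Abs_filter)
  have "G = F"
  proof (rule minimal)
    show GF: "G \<le> F"
      unfolding le_filter_def G by (blast dest: idem intro: eventually_mono pF)
    have "idempotent_filter G"
      unfolding idempotent_filter_def
    proof (intro allI impI)
      fix P assume P: "eventually P G"
      \<comment> \<open>\<open>P\<close> holds along \<open>G\<close> exactly when \<open>X\<close>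
        holds along \<open>F\<close>. Idempotence of \<open>F\<close> is applied to
        \<open>X\<close>, and associativity carries the result back to \<open>P\<close> and
        \<open>G\<close>.\<close>
      define X where "X x \<longleftrightarrow> (\<forall>\<^sub>F y in p. P (x + y))" for x
      have "eventually X F" using P by (simp add: G X_def[abs_def])
      then have "\<forall>\<^sub>F y in F. \<forall>\<^sub>F x in F. X (y + x)" by (rule idem)
      then have "\<forall>\<^sub>F y in F. \<forall>\<^sub>F z in G. P (y + z)" by (simp add: G X_def add.assoc)
      then show "\<forall>\<^sub>F y in G. \<forall>\<^sub>F z in G. P (y + z)" by (rule filter_leD[OF GF])
    qed
    moreover have "G \<noteq> bot"
      using F(2) p(2) G[of "\<lambda>_. False"] by (auto simp: trivial_limit_def)
    ultimately show "G \<noteq> bot \<and> idempotent_filter G" by simp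
  qed
  \<comment> \<open>The Ellis argument now passes to the points \<open>x\<close> with
    \<open>x + p = p\<close>. Its filter form is \<open>H\<close>, which refines \<open>F\<close> by
    all sets \<open>sh P\<close> with \<open>P\<close> in \<open>p\<close>.\<close>
  define sh where "sh P x \<longleftrightarrow> (\<forall>\<^sub>F y in p. P (x + y))" for P x
  define H where "H = Abs_filter (\<lambda>Z. \<exists>X P. eventually X F \<and> eventually P p \<and> (\<forall>x. X x \<and> sh P x \<longrightarrow> Z x))"
  have "is_filter (\<lambda>Z. \<exists>X P. eventually X F \<and> eventually P p \<and> (\<forall>x. X x \<and> sh P x \<longrightarrow> Z x))"
  proof
    show "\<exists>X P. eventually X F \<and> eventually P p \<and> (\<forall>x. X x \<and> sh P x \<longrightarrow> True)"
      using eventually_True by blast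
  next
    fix Z Z'
    assume "\<exists>X P. eventually X F \<and> eventually P p \<and> (\<forall>x. X x \<and> sh P x \<longrightarrow> Z x)"
      and "\<exists>X P. eventually X F \<and> eventually P p \<and> (\<forall>x. X x \<and> sh P x \<longrightarrow> Z' x)"
    then obtain X P X' P' where 1: "eventually X F" "eventually P p" "\<forall>x. X x \<and> sh P x \<longrightarrow> Z x"
      "eventually X' F" "eventually P' p" "\<forall>x. X' x \<and> sh P' x \<longrightarrow> Z' x" by blast
    have "sh P x \<and> sh P' x" if "sh (\<lambda>x. P x \<and> P' x) x" for x
      using that by (simp add: sh_def eventually_conj_iff)
    with 1 show "\<exists>X P. eventually X F \<and> eventually P p \<and> (\<forall>x. X x \<and> sh P x \<longrightarrow> Z x \<and> Z' x)"
      by (intro exI[of _ "\<lambda>x. X x \<and> X' x"] exI[of _ "\<lambda>x. P x \<and> P' x"]) (auto simp: eventually_conj_iff)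
  qed blast
  then have H: "eventually Z H \<longleftrightarrow> (\<exists>X P. eventually X F \<and> eventually P p \<and> (\<forall>x. X x \<and> sh P x \<longrightarrow> Z x))" for Z
    by (simp add: H_def eventually_Abs_filter)
  have H1: "eventually Z H" if "eventually Z F" for Z
    unfolding H using that eventually_True by blast
  have H2: "eventually (sh P) H" if "eventually P p" for P
    unfolding H using that eventually_True by blast
  have "H = F"
  proof (rule minimal)
    show HF: "H \<le> F" by (simp add: le_filter_def H1)
    have "H \<noteq> bot"
    proof
      assume "H = bot"
      then obtain X P where X: "eventually X F" "eventually P p" "\<And>x. X x \<Longrightarrow> \<not> sh P x"
        using H[of "\<lambda>_. False"] by auto
      \<comment> \<open>As \<open>p\<close> is an ultrafilter, failure of \<open>sh P\<close> at
        \<open>x\<close> means that \<open>P (x + y)\<close> fails for \<open>p\<close>-most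
        \<open>y\<close>. The negation of \<open>P\<close> is then in \<open>F + p = F\<close>,
        hence in \<open>p\<close>.\<close>
      have "\<forall>\<^sub>F x in F. \<forall>\<^sub>F y in p. \<not> P (x + y)"
        using X(1) by (rule eventually_mono) (use X(3) p(3) sh_def in blast)
      then have "eventually (\<lambda>x. \<not> P x) p" using G \<open>G = F\<close> pF by blast
      with X(2) have "eventually (\<lambda>_. False) p" by eventually_elim simp
      with p(2) show False by (simp add: trivial_limit_def)
    qed
    moreover have "idempotent_filter H"
      unfolding idempotent_filter_def
    proof (intro allI impI)
      fix Z assume "eventually Z H"
      then obtain X P where X: "eventually X F" "eventually P p" "\<And>x. X x \<Longrightarrow> sh P x \<Longrightarrow> Z x"
        using H by blast
      have "\<forall>\<^sub>F x in H. \<forall>\<^sub>F y in H. X (x + y)"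
        using idem[OF X(1)] by (intro H1) (auto elim!: eventually_mono intro: H1)
      moreover have "\<forall>\<^sub>F x in H. \<forall>\<^sub>F y in H. sh P (x + y)"
        using H2[OF X(2)]
      proof (rule eventually_mono)
        fix x assume "sh P x"
        \<comment> \<open>\<open>sh P x\<close> says that the translate of \<open>P\<close> by
          \<open>x\<close> is in \<open>p\<close>, so its own \<open>sh\<close> set is in
          \<open>H\<close>; by associativity this set consists of the \<open>y\<close> with
          \<open>sh P (x + y)\<close>.\<close>
        then have "eventually (sh (\<lambda>y. P (x + y))) H" by (intro H2) (simp add: sh_def)
        then show "\<forall>\<^sub>F y in H. sh P (x + y)" by (simp add: sh_def[abs_def] add.assoc)
      qed
      ultimately show "\<forall>\<^sub>F x in H. \<forall>\<^sub>F y in H. Z (x + y)"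
        by eventually_elim (auto elim: eventually_elim2 intro: X(3))
    qed
    ultimately show "H \<noteq> bot \<and> idempotent_filter H" by simp
  qed
  \<comment> \<open>By \<open>H = F\<close>, every \<open>P\<close> in \<open>p\<close> has
    \<open>sh P\<close> in \<open>F\<close>, which means that \<open>P\<close> is in
    \<open>F + p = F\<close>. So \<open>F\<close> is as fine as \<open>p\<close>.\<close>
  have "eventually P F" if "eventually P p" for P
    using H2[OF that] \<open>H = F\<close> \<open>G = F\<close> G by (simp add: sh_def[abs_def])
  then have "F = p" using p(1) by (intro antisym) (auto simp: le_filter_def)
  then show ?thesis using that F p by blast
qed

section \<open>Hindman's theorem for countably many sets\<close>

lemma FS_I: "finite K \<Longrightarrow> K \<noteq> {} \<Longrightarrow> K \<subseteq> D \<Longrightarrow> \<Sum>K \<in> FS D"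
  unfolding FS_def by (rule CollectI, rule exI[of _ K]) simp

lemma FS_E:
  assumes "x \<in> FS D"
  obtains K where "finite K" "K \<noteq> {}" "K \<subseteq> D" "x = \<Sum>K"
  using assms unfolding FS_def by blast

lemma FS_mono:
  assumes "D \<subseteq> E"
  shows "FS D \<subseteq> FS E"
proof
  fix x assume "x \<in> FS D"
  then obtain K where K: "finite K" "K \<noteq> {}" "K \<subseteq> D" "x = \<Sum>K" by (rule FS_E)
  then show "x \<in> FS E" using FS_I[of K E] assms by auto
qed

lemma FS_singleton: "x \<in> D \<Longrightarrow> x \<in> FS D"
  using FS_I[of "{x}" D] by simp

lemma infinite_FS: "infinite D \<Longrightarrow> infinite (FS D)"
  using infinite_super[of D "FS D"] FS_singleton by blast

text \<open>Once the finitely many summands of \<open>x\<close> are set aside, further sums can be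
  added without repeating a summand. This makes the tail filter of \<open>FS\<close>
  idempotent.\<close>

lemma FS_add:
  assumes "x \<in> FS D" 
  obtains K where "finite K" "K \<subseteq> D" "\<And>y. y \<in> FS (D - K) \<Longrightarrow> x + y \<in> FS D"
proof -
  obtain K where K: "finite K" "K \<noteq> {}" "K \<subseteq> D" "x = \<Sum>K" using assms by (rule FS_E)
  have "x + y \<in> FS D" if y: "y \<in> FS (D - K)" for y
  proof -
    obtain L where L: "finite L" "L \<noteq> {}" "L \<subseteq> D - K" "y = \<Sum>L"
      using FS_E[OF y] by blast
    have "K \<inter> L = {}" using L(3) by blast
    moreover have "\<Sum>(K \<union> L) \<in> FS D" using K L by (intro FS_I) auto
    ultimately show ?thesis using K(1,4) L(1,4) by (simp add: sum.union_disjoint)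
  qed
  then show ?thesis using that K by blast
qed

lemma mono_FS: "mono FS"
  by (intro monoI FS_mono)

text \<open>The Galvin--Glazer argument, run against countably many sets at once.\<close>

lemma diagonally_Ramsey_FS: "diagonally_Ramsey FS"
  unfolding diagonally_Ramsey_def
proof (intro conjI allI impI mono_FS)
  fix D :: "nat set" and S :: "nat \<Rightarrow> nat set"
  assume D: "infinite D"
  define F0 where "F0 = tail_filter FS D"
  have F0: "eventually P F0 \<longleftrightarrow> (\<exists>K. finite K \<and> (\<forall>x\<in>FS (D - K). P x))" for P
    by (simp add: F0_def eventually_tail_filter[OF mono_FS])
  have "F0 \<noteq> bot"
    unfolding F0_def using infinite_FS D by (intro tail_filter_neq_bot[OF mono_FS]) force+
  moreover have "idempotent_filter F0"
    unfolding idempotent_filter_def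
  proof (intro allI impI)
    fix P assume "eventually P F0"
    then obtain K where K: "finite K" "\<forall>x\<in>FS (D - K). P x" using F0 by blast
    have "\<forall>\<^sub>F y in F0. P (x + y)" if x: "x \<in> FS (D - K)" for x
    proof -
      obtain L where L: "finite L" "L \<subseteq> D - K" "\<And>y. y \<in> FS (D - K - L) \<Longrightarrow> x + y \<in> FS (D - K)"
        using FS_add[OF x] by blast
      have "D - (K \<union> L) = D - K - L" by blast
      then show ?thesis
        unfolding F0 using K L by (intro exI[of _ "K \<union> L"]) simp
    qed
    then show "\<forall>\<^sub>F x in F0. \<forall>\<^sub>F y in F0. P (x + y)" 
      unfolding F0[of "\<lambda>x. eventually (\<lambda>y. P (x + y)) F0"] using K by blast
  qed
  ultimately obtain p where p: "p \<le> F0" "p \<noteq> bot" "idempotent_filter p"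
    "\<And>P. eventually P p \<or> eventually (\<lambda>x. \<not> P x) p"
    using idempotent_ultrafilter_exists by blast
  \<comment> \<open>A sum over a subset of \<open>D - {..m}\<close> has a summand above
    \<open>m\<close>. This lets the points below be chosen strictly increasing.\<close>
  have gt: "\<forall>\<^sub>F x in p. x > m" for m
  proof (rule filter_leD[OF p(1)], unfold F0, intro exI[of _ "{..m}"] conjI ballI)
    fix x assume "x \<in> FS (D - {..m})"
    then obtain L where L: "finite L" "L \<noteq> {}" "L \<subseteq> D - {..m}" "x = \<Sum>L" by (rule FS_E)
    then obtain l where "l \<in> L" by blast
    then have "l > m" "l \<le> x" using L by (auto intro: member_le_sum)
    then show "x > m" by simp
  qed simp
  have inD: "\<forall>\<^sub>F x in p. x \<in> FS D"
    by (rule filter_leD[OF p(1)], unfold F0) (intro exI[of _ "{}"], simp)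
  \<comment> \<open>\<open>T n\<close> is whichever of \<open>S n\<close> and its complement belongs
    to \<open>p\<close>.\<close>
  define T where "T n = (if \<forall>\<^sub>F x in p. x \<in> S n then S n else - S n)" for n
  have T: "\<forall>\<^sub>F x in p. x \<in> T n" for n
    using p(4)[of "\<lambda>x. x \<in> S n"] by (auto simp: T_def)
  \<comment> \<open>A good point of \<open>R\<close> is one whose translate of \<open>R\<close> is
    again in \<open>p\<close>; idempotence supplies such points beyond every bound.\<close>
  let ?good = "\<lambda>R x. eventually R p \<and> R x \<and> (\<forall>\<^sub>F y in p. R (x + y))"
  have good: "\<exists>x>m. ?good R x" if "eventually R p" for R m
  proof -
    have "\<forall>\<^sub>F x in p. x > m \<and> R x \<and> (\<forall>\<^sub>F y in p. R (x + y))"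
      using gt[of m] that idempotent_filterD[OF p(3) that] by eventually_elim simp
    then show ?thesis using that p(2) eventually_happens by blast
  qed
  \<comment> \<open>\<open>h n\<close> pairs a set in \<open>p\<close> with a good point of it. The
    next set lies inside the current one, inside its translate by that point, and inside
    \<open>T (Suc n)\<close>.\<close>
  have "\<exists>h. \<forall>n. ((\<forall>x. fst (h n) x \<longrightarrow> x \<in> T n \<inter> FS D) \<and> ?good (fst (h n)) (snd (h n))) \<and>
     (snd (h (Suc n)) > snd (h n) \<and>
      (\<forall>y. fst (h (Suc n)) y \<longrightarrow> fst (h n) y \<and> fst (h n) (snd (h n) + y)))"
  proof (rule dependent_nat_choice[where
        P = "\<lambda>n z. (\<forall>x. fst z x \<longrightarrow> x \<in> T n \<inter> FS D) \<and> ?good (fst z) (snd z)" and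
        Q = "\<lambda>n z z'. snd z' > snd z \<and> (\<forall>y. fst z' y \<longrightarrow> fst z y \<and> fst z (snd z + y))"])
    have "\<forall>\<^sub>F x in p. x \<in> T 0 \<inter> FS D" using T[of 0] inD by eventually_elim simp
    from good[OF this] obtain x where "?good (\<lambda>x. x \<in> T 0 \<inter> FS D) x" by blast
    then show "\<exists>z. (\<forall>x. fst z x \<longrightarrow> x \<in> T 0 \<inter> FS D) \<and> ?good (fst z) (snd z)"
      by (intro exI[of _ "(\<lambda>x. x \<in> T 0 \<inter> FS D, x)"]) simp
  next
    fix z n assume z: "(\<forall>x. fst z x \<longrightarrow> x \<in> T n \<inter> FS D) \<and> ?good (fst z) (snd z)"
    define R where "R y \<longleftrightarrow> y \<in> T (Suc n) \<inter> FS D \<and> fst z y \<and> fst z (snd z + y)" for y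
    have z1: "eventually (fst z) p" and z2: "\<forall>\<^sub>F y in p. fst z (snd z + y)" using z by auto
    have "eventually R p"
      unfolding R_def using T[of "Suc n"] inD z1 z2 by eventually_elim simp
    from good[OF this, of "snd z"] obtain x where "x > snd z" "?good R x" by blast
    then show "\<exists>z'. ((\<forall>x. fst z' x \<longrightarrow> x \<in> T (Suc n) \<inter> FS D) \<and> ?good (fst z') (snd z')) \<and>
       (snd z' > snd z \<and> (\<forall>y. fst z' y \<longrightarrow> fst z y \<and> fst z (snd z + y)))"
      by (intro exI[of _ "(R, x)"]) (auto simp: R_def)
  qed
  then obtain h where h: "\<And>n x. fst (h n) x \<Longrightarrow> x \<in> T n \<inter> FS D"
    "\<And>n. fst (h n) (snd (h n))" "\<And>n. snd (h (Suc n)) > snd (h n)"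
    "\<And>n y. fst (h (Suc n)) y \<Longrightarrow> fst (h n) y \<and> fst (h n) (snd (h n) + y)"
    by blast
  define x where "x n = snd (h n)" for n
  define R where "R n = fst (h n)" for n
  have smx: "strict_mono x" by (simp add: strict_mono_Suc_iff x_def h)
  have Rmono: "R n y" if "R m y" "n \<le> m" for n m y
    using that(2,1) by (induction rule: dec_induct) (use h(4) R_def in auto)
  \<comment> \<open>The least index \<open>m\<close> is split off: the remaining sum lies in
    \<open>R (Suc m)\<close>, so adding \<open>x m\<close> leads into \<open>R m\<close>, which is
    contained in \<open>R n\<close>.\<close>
  have sums: "R n (\<Sum>i\<in>I. x i)" if "finite I" "I \<noteq> {}" "\<And>i. i \<in> I \<Longrightarrow> n \<le> i" for n I
    using that
  proof (induction "card I" arbitrary: I n)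
    case 0
    then show ?case by simp
  next
    case (Suc k)
    define m where "m = Min I"
    have m: "m \<in> I" "n \<le> m" using Suc by (auto simp: m_def)
    have "R m (\<Sum>i\<in>I. x i)"
    proof (cases "I - {m} = {}")
      case True
      then have "I = {m}" using m by blast
      then show ?thesis using h(2) by (simp add: R_def x_def)
    next
      case False
      have "Suc m \<le> i" if "i \<in> I - {m}" for i
      proof -
        have "m \<le> i" using that Suc.prems by (simp add: m_def)
        then show ?thesis using that by auto
      qed
      moreover have "k = card (I - {m})" using Suc.hyps(2) m Suc.prems by simp
      ultimately have "R (Suc m) (\<Sum>i\<in>I-{m}. x i)"
        using False Suc.prems by (intro Suc.hyps(1)) auto
      then have "R m (x m + (\<Sum>i\<in>I-{m}. x i))" using h(4) by (simp add: R_def x_def)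
      then show ?thesis using Suc.prems m by (simp add: sum.remove)
    qed
    then show ?case using m(2) Rmono by blast
  qed
  have sumR: "R n y" if y: "y \<in> FS (range x - x ` {..<n})" for n y
  proof -
    obtain L where L: "finite L" "L \<noteq> {}" "L \<subseteq> range x - x ` {..<n}" "y = \<Sum>L"
      using y by (rule FS_E)
    define I where "I = x -` L"
    have inj: "inj x" using smx strict_mono_imp_inj_on by blast
    have LI: "L = x ` I" using L(3) by (auto simp: I_def)
    have "finite I" unfolding I_def using L(1) inj by (simp add: finite_vimageI)
    moreover have "I \<noteq> {}" using LI L(2) by auto
    moreover have "n \<le> i" if "i \<in> I" for i
      using that L(3) unfolding I_def by (metis DiffD2 imageI lessThan_iff not_le subsetD vimageE)
    ultimately have "R n (\<Sum>i\<in>I. x i)" by (rule sums)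
    also have "(\<Sum>i\<in>I. x i) = y"
      unfolding L(4) LI using inj by (subst sum.reindex) (auto simp: inj_on_def)
    finally show ?thesis .
  qed
  show "\<exists>E. infinite E \<and> FS E \<subseteq> FS D \<and>
      (\<forall>n. (\<forall>\<^sub>F y in tail_filter FS E. y \<in> S n) \<or> (\<forall>\<^sub>F y in tail_filter FS E. y \<notin> S n))"
  proof (rule exI[of _ "range x"], intro conjI allI)
    show "infinite (range x)"
      using smx strict_mono_imp_inj_on range_inj_infinite by blast
    show "FS (range x) \<subseteq> FS D"
      using sumR[of _ 0] h(1)[of 0] by (auto simp: R_def)
    fix n
    have "FS (range x - x ` {..<n}) \<subseteq> T n" using sumR[of _ n] h(1)[of n] by (auto simp: R_def)
    then have "\<forall>\<^sub>F y in tail_filter FS (range x). y \<in> T n"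
      unfolding eventually_tail_filter[OF mono_FS] by (intro exI[of _ "x ` {..<n}"]) auto
    then show "(\<forall>\<^sub>F y in tail_filter FS (range x). y \<in> S n) \<or>
        (\<forall>\<^sub>F y in tail_filter FS (range x). y \<notin> S n)"
      by (auto simp: T_def split: if_splits)
  qed
qed

section \<open>Ideals and the summable ideal\<close>

lemma ideal_on_subset: "ideal_on \<Lambda> \<I> \<Longrightarrow> A \<in> \<I> \<Longrightarrow> B \<subseteq> A \<Longrightarrow> B \<in> \<I>"
  unfolding ideal_on_def by blast

lemma ideal_on_Un: "ideal_on \<Lambda> \<I> \<Longrightarrow> A \<in> \<I> \<Longrightarrow> B \<in> \<I> \<Longrightarrow> A \<union> B \<in> \<I>"
  unfolding ideal_on_def by blast

lemma ideal_on_finite: "ideal_on \<Lambda> \<I> \<Longrightarrow> finite F \<Longrightarrow> F \<subseteq> \<Lambda> \<Longrightarrow> F \<in> \<I>"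
  unfolding ideal_on_def by blast

lemma ideal_on_Union:
  assumes "ideal_on \<Lambda> \<I>" "finite I" "\<And>i. i \<in> I \<Longrightarrow> A i \<in> \<I>"
  shows "(\<Union>i\<in>I. A i) \<in> \<I>"
  using assms(2,3)
  by (induction I rule: finite_induct) (use ideal_on_Un[OF assms(1)] ideal_on_finite[OF assms(1)] in auto)

text \<open>If no fibre of \<open>g\<close> is eventual, every fibre is eventually avoided, and so
  is the finite union of the fibres up to any bound.\<close>

lemma decided_limit:
  fixes g :: "'l \<Rightarrow> nat"
  assumes "\<And>m. (\<forall>\<^sub>F y in F. g y = m) \<or> (\<forall>\<^sub>F y in F. g y \<noteq> m)"
  obtains m where "\<forall>\<^sub>F y in F. g y = m" | "\<And>N. \<forall>\<^sub>F y in F. g y > N"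
proof (cases "\<exists>m. \<forall>\<^sub>F y in F. g y = m")
  case False
  have "\<forall>\<^sub>F y in F. g y > N" for N
  proof -
    have "\<forall>\<^sub>F y in F. \<forall>m\<in>{..N}. g y \<noteq> m"
      using assms False by (intro eventually_ball_finite) auto
    then show ?thesis by (rule eventually_mono) (metis atMost_iff leI)
  qed
  then show ?thesis using that by blast
qed (use that in blast)

text \<open>Limits are taken in the one-point compactification of the naturals, with
  \<open>\<infinity>\<close> for values outgrowing every bound.\<close>

definition limit_along :: "'l filter \<Rightarrow> ('l \<Rightarrow> nat) \<Rightarrow> enat \<Rightarrow> bool" where
  "limit_along F g l \<longleftrightarrow> (\<exists>m. l = enat m \<and> (\<forall>\<^sub>F y in F. g y = m)) \<or> (l = \<infinity> \<and> (\<forall>N. \<forall>\<^sub>F y in F. g y > N))"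

lemma limit_along_exists:
  assumes "\<And>m. (\<forall>\<^sub>F y in F. g y = m) \<or> (\<forall>\<^sub>F y in F. g y \<noteq> m)"
  shows "\<exists>l. limit_along F g l"
  using decided_limit[OF assms] unfolding limit_along_def by metis

lemma limit_along_eventually:
  assumes "limit_along F g l"
  shows "\<forall>\<^sub>F y in F. enat (g y) = l \<or> enat (g y) > enat N"
  using assms unfolding limit_along_def by (auto elim: eventually_mono)

text \<open>The set formed by \<open>l'\<close> and everything above \<open>N\<close> is closed, so
  it contains the limit of values in it. This compares the limit at a new stem with the limit at the
  old one.\<close>

lemma limit_along_close:
  assumes "limit_along F g l" "F \<noteq> bot" "\<forall>\<^sub>F y in F. enat (g y) = l' \<or> enat (g y) > enat N"
  shows "l = l' \<or> l > enat N"
proof (cases l)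
  case (enat m)
  then have "\<forall>\<^sub>F y in F. g y = m" using assms(1) by (auto simp: limit_along_def)
  with assms(3) have "\<forall>\<^sub>F y in F. g y = m \<and> (enat (g y) = l' \<or> enat (g y) > enat N)"
    by eventually_elim simp
  then show ?thesis using eventually_happens'[OF assms(2)] enat by blast
qed simp

text \<open>At most \<open>2 * 2 ^ n\<close> points of weight at most \<open>1 / 4 ^ n\<close>
  contribute at most \<open>2 / 2 ^ n\<close>, and these bounds add up to 4.\<close>

lemma summable_ideal_Union:
  fixes W :: "nat \<Rightarrow> nat set"
  assumes "\<And>n. finite (W n)" "\<And>n. card (W n) \<le> 2 * 2 ^ n" "\<And>n v. v \<in> W n \<Longrightarrow> v > 4 ^ n"
  shows "(\<Union>n. W n) \<in> summable_ideal"
proof -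
  let ?f = "\<lambda>n. 1 / (real n + 1)"
  \<comment> \<open>The sets \<open>W n\<close> may overlap, so each point is charged to the first
    one containing it.\<close>
  define k where "k v = (LEAST n. v \<in> W n)" for v
  have "sum ?f F \<le> 4" if F: "F \<subseteq> (\<Union>n. W n)" "finite F" for F
  proof -
    have k: "v \<in> W (k v)" if v: "v \<in> F" for v
    proof -
      obtain n where "v \<in> W n" using v F by blast
      then show ?thesis unfolding k_def by (rule LeastI)
    qed
    have block: "sum ?f {v \<in> F. k v = n} \<le> 2 * (1 / 2) ^ n" for n
    proof -
      have sub: "{v \<in> F. k v = n} \<subseteq> W n" using k by auto
      have "sum ?f {v \<in> F. k v = n} \<le> (\<Sum>v\<in>{v \<in> F. k v = n}. (1 / 4) ^ n)"
      proof (rule sum_mono)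
        fix v assume "v \<in> {v \<in> F. k v = n}"
        then have "4 ^ n < v" using sub assms(3) by blast
        then have "real (4 ^ n) \<le> real v + 1" by (metis Suc_eq_plus1 less_SucI less_imp_le of_nat_1 of_nat_add of_nat_le_iff)
        then have "?f v \<le> 1 / real (4 ^ n)" by (intro frac_le) auto
        then show "?f v \<le> (1 / 4) ^ n" by (simp add: power_one_over)
      qed
      also have "\<dots> = real (card {v \<in> F. k v = n}) * (1 / 4) ^ n" by simp
      also have "\<dots> \<le> (2 * 2 ^ n) * (1 / 4) ^ n"
      proof (rule mult_right_mono)
        have "card {v \<in> F. k v = n} \<le> 2 * 2 ^ n"
          using card_mono[OF assms(1) sub] assms(2)[of n] by linarith
        then have "real (card {v \<in> F. k v = n}) \<le> real (2 * 2 ^ n)" by (simp only: of_nat_le_iff)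
        then show "real (card {v \<in> F. k v = n}) \<le> 2 * 2 ^ n" by simp
      qed simp
      also have "\<dots> = 2 * (1 / 2) ^ n"
        by (simp flip: power_mult_distrib)
      finally show ?thesis .
    qed
    have "sum ?f F = (\<Sum>n\<in>k ` F. sum ?f {v \<in> F. k v = n})"
      using F(2) by (rule sum.image_gen)
    also have "\<dots> \<le> (\<Sum>n\<in>k ` F. 2 * (1 / 2) ^ n)" by (intro sum_mono block)
    also have "\<dots> \<le> (\<Sum>n. 2 * (1 / 2) ^ n)"
      using F(2) by (intro sum_le_suminf) (auto intro: summable_mult)
    also have "\<dots> = 4" by (subst suminf_mult) (auto simp: suminf_geometric)
    finally show ?thesis .
  qed
  then show ?thesis
    unfolding summable_ideal_def mem_Collect_eq
    by (intro nonneg_bdd_above_summable_on bdd_aboveI[where M = 4]) auto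
qed

lemma ideal_on_summable_ideal: "ideal_on UNIV summable_ideal"
  unfolding ideal_on_def
proof (intro conjI ballI allI impI)
  let ?f = "\<lambda>n. 1 / (real n + 1)"
  show "summable_ideal \<noteq> {}" by (auto simp: summable_ideal_def intro: exI[of _ "{}"])
  show "B \<in> summable_ideal" if "A \<in> summable_ideal" "B \<subseteq> A" for A B
    using that summable_on_subset_banach by (auto simp: summable_ideal_def)
  show "A \<union> B \<in> summable_ideal" if "A \<in> summable_ideal" "B \<in> summable_ideal" for A B
  proof -
    have "?f summable_on (A \<union> (B - A))"
      using that summable_on_subset_banach[of ?f B "B - A"]
      by (intro summable_on_Un_disjoint) (auto simp: summable_ideal_def)
    then show ?thesis by (simp add: summable_ideal_def)
  qed
  show "F \<in> summable_ideal" if "finite F \<and> F \<subseteq> UNIV" for F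
    using that by (simp add: summable_ideal_def)
  show "UNIV \<notin> summable_ideal"
  proof
    assume "UNIV \<in> summable_ideal"
    then have "?f summable_on UNIV" by (simp add: summable_ideal_def)
    then have "summable ?f" by (simp add: summable_on_UNIV_nonneg_real_iff)
    then have "summable (\<lambda>n. inverse (real (Suc n)))" by (simp add: field_simps)
    then have "summable (\<lambda>n. inverse (real n))" by (subst (asm) summable_Suc_iff)
    then show False using not_summable_harmonic[where 'a = real] by simp
  qed
qed simp

text \<open>The elements \<open>s\<close> of \<open>St n\<close> are the stems that can be formed from \<open>x 0, \<dots>, x (n - 1)\<close>, and
  \<open>L s\<close> is the limit of the values \<open>g s\<close>. Every value, and every limit at a new stem, is either
  an older limit or larger than \<open>4 ^ n\<close>, while there are at most \<open>2 ^ n\<close> stems.\<close>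

lemma fusion_summable:
  fixes g :: "'k \<Rightarrow> nat \<Rightarrow> enat"
  assumes "infinite E"
    and lim: "\<And>s N. \<exists>K. finite K \<and> (\<forall>x\<in>E - K. (g s x = L s \<or> g s x > enat N) \<and>
               (L (nxt s x) = L s \<or> L (nxt s x) > enat N))"
  obtains x St where "strict_mono x" "range x \<subseteq> E" "St 0 = {s0}"
    "\<And>n. St (Suc n) = St n \<union> (\<lambda>s. nxt s (x n)) ` St n"
    "{v. \<exists>n. \<exists>s\<in>St n. g s (x n) = enat v} \<in> summable_ideal"
proof -
  \<comment> \<open>Under \<open>?ok N s x\<close>, neither the value at \<open>x\<close> nor the
    limit at the new stem is a number up to \<open>N\<close> other than \<open>L s\<close>.\<close>
  let ?ok = "\<lambda>N s x. (g s x = L s \<or> g s x > enat N) \<and> (L (nxt s x) = L s \<or> L (nxt s x) > enat N)"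
  have next_point: "\<exists>x\<in>E. x > m \<and> (\<forall>s\<in>T. ?ok N s x)" if T: "finite T" for T N m
  proof -
    from lim have "\<forall>s. \<exists>K. finite K \<and> (\<forall>x\<in>E - K. ?ok N s x)" by blast
    then obtain K where K: "\<And>s. finite (K s)" "\<And>s x. x \<in> E - K s \<Longrightarrow> ?ok N s x" by metis
    have "infinite (E - ({..m} \<union> (\<Union>s\<in>T. K s)))" using assms(1) K(1) T by simp
    then obtain x where "x \<in> E - ({..m} \<union> (\<Union>s\<in>T. K s))"
      using infinite_imp_nonempty by blast
    then show ?thesis using K(2) by (intro bexI[of _ x]) auto
  qed
  \<comment> \<open>\<open>fst z\<close> is the set of stems and \<open>snd z\<close> the next
    point. Each point at most doubles the stems, whence \<open>2 ^ n\<close>; the clause for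
    \<open>n = 0\<close> records the initial stem through the dependent choice.\<close>
  let ?P = "\<lambda>n z. finite (fst z) \<and> card (fst z) \<le> 2 ^ n \<and> snd z \<in> E \<and> (\<forall>s\<in>fst z. ?ok (4 ^ n) s (snd z))
      \<and> (n = 0 \<longrightarrow> fst z = {s0})"
  let ?Q = "\<lambda>z z'. fst z' = fst z \<union> (\<lambda>s. nxt s (snd z)) ` fst z \<and> snd z < snd z'"
  have "\<exists>h. \<forall>n. ?P n (h n) \<and> ?Q (h n) (h (Suc n))"
  proof (rule dependent_nat_choice[where P = ?P and Q = "\<lambda>n. ?Q"])
    obtain x where "x \<in> E" "\<forall>s\<in>{s0}. ?ok (4 ^ 0) s x" using next_point[of "{s0}" 0 "4 ^ 0"] by blast
    then show "\<exists>z. ?P 0 z" by (intro exI[of _ "({s0}, x)"]) simp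
  next
    fix z n assume z: "?P n z"
    define T where "T = fst z \<union> (\<lambda>s. nxt s (snd z)) ` fst z"
    have T: "finite T" using z by (simp add: T_def)
    have "card T \<le> card (fst z) + card ((\<lambda>s. nxt s (snd z)) ` fst z)"
      unfolding T_def by (rule card_Un_le)
    also have "\<dots> \<le> card (fst z) + card (fst z)" using z by (simp add: card_image_le)
    also have "\<dots> \<le> 2 ^ Suc n" using z by simp
    finally have card: "card T \<le> 2 ^ Suc n" .
    obtain x where "x \<in> E" "x > snd z" "\<forall>s\<in>T. ?ok (4 ^ Suc n) s x" using next_point[OF T] by blast
    then show "\<exists>z'. ?P (Suc n) z' \<and> ?Q z z'"
      using T card by (intro exI[of _ "(T, x)"]) (simp add: T_def)
  qed
  then obtain h where "\<forall>n. ?P n (h n) \<and> ?Q (h n) (h (Suc n))" by (rule exE)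
  then have h: "?P n (h n)" "?Q (h n) (h (Suc n))" for n by simp_all
  define x where "x n = snd (h n)" for n
  define St where "St n = fst (h n)" for n
  have xS: "finite (St n)" "card (St n) \<le> 2 ^ n" "x n \<in> E" "St 0 = {s0}"
    "St (Suc n) = St n \<union> (\<lambda>s. nxt s (x n)) ` St n" "x n < x (Suc n)" for n
    using h(1)[of n] h(1)[of 0] h(2)[of n] by (simp_all add: x_def St_def)
  have ok: "?ok (4 ^ n) s (x n)" if "s \<in> St n" for n s
    using h(1)[of n] that by (simp add: x_def St_def)
  \<comment> \<open>Values and limits account for at most \<open>card (St n)\<close> numbers each,
    whence the factor 2. Whatever \<open>the_enat\<close> returns at \<open>\<infinity>\<close> does
    no harm: \<open>W n\<close> keeps only numbers above \<open>4 ^ n\<close>, and the count is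
    unaffected.\<close>
  let ?V = "\<lambda>n. (\<lambda>s. the_enat (g s (x n))) ` St n \<union> (\<lambda>s. the_enat (L (nxt s (x n)))) ` St n"
  define W where "W n = {v \<in> ?V n. v > 4 ^ n}" for n
  have Wsub: "W n \<subseteq> ?V n" for n by (auto simp: W_def)
  have W1: "v \<in> W n" if "s \<in> St n" "g s (x n) = enat v" "v > 4 ^ n" for s v n
    unfolding W_def using that by (auto intro!: image_eqI[of _ _ s])
  have W2: "v \<in> W n" if "s \<in> St n" "L (nxt s (x n)) = enat v" "v > 4 ^ n" for s v n
    unfolding W_def using that by (auto intro!: image_eqI[of _ _ s])
  have "card (?V n) \<le> card (St n) + card (St n)" for n
    using xS(1)[of n] by (intro order_trans[OF card_Un_le] add_mono card_image_le)
  moreover have "card (W n) \<le> card (?V n)" for n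
    using Wsub xS(1) by (intro card_mono) auto
  ultimately have "card (W n) \<le> card (St n) + card (St n)" for n by (rule order_trans[rotated])
  moreover have "card (St n) + card (St n) \<le> 2 * 2 ^ n" for n using xS(2)[of n] by simp
  ultimately have "card (W n) \<le> 2 * 2 ^ n" for n by (rule order_trans)
  moreover have "finite (W n)" for n using finite_subset[OF Wsub] xS(1) by blast
  ultimately have UW: "(\<Union>n. W n) \<in> summable_ideal"
    by (intro summable_ideal_Union) (auto simp: W_def)
  \<comment> \<open>The limit at the initial stem is not bounded below by the fusion, but it adds at
    most one number.\<close>
  define V0 where "V0 = {v. L s0 = enat v}"
  have "finite V0"
  proof (cases "L s0")
    case (enat m)
    then have "V0 \<subseteq> {m}" by (auto simp: V0_def)
    then show ?thesis using finite_subset by blast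
  qed (simp add: V0_def)
  \<comment> \<open>While a stem is built up, its limit changes only to values above the current
    bound. A finite limit is therefore that of \<open>s0\<close>, or it entered some
    \<open>W n\<close> when it first appeared.\<close>
  have Lval: "v \<in> V0 \<union> (\<Union>n. W n)" if "s \<in> St n" "L s = enat v" for n s v
    using that
  proof (induction n arbitrary: s)
    case 0
    then show ?case using xS(4) by (simp add: V0_def)
  next
    case (Suc n)
    show ?case
    proof (cases "s \<in> St n")
      case False
      then obtain t where t: "t \<in> St n" "s = nxt t (x n)" using Suc.prems xS(5) by auto
      show ?thesis
      proof (cases "L s = L t")
        case True
        then show ?thesis using Suc t by metis
      next
        case False
        then have "v > 4 ^ n" using ok[OF t(1)] t(2) Suc.prems by simp
        then have "v \<in> W n" using t Suc.prems W2 by blast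
        then show ?thesis by blast
      qed
    qed (use Suc in blast)
  qed
  have "{v. \<exists>n. \<exists>s\<in>St n. g s (x n) = enat v} \<subseteq> V0 \<union> (\<Union>n. W n)"
  proof clarify
    fix v n s assume s: "s \<in> St n" "g s (x n) = enat v" "v \<notin> (\<Union>n. W n)"
    show "v \<in> V0"
    proof (cases "g s (x n) = L s")
      case True
      then have "L s = enat v" using s(2) by simp
      from Lval[OF s(1) this] show ?thesis using s(3) by blast
    next
      case False
      then have "v > 4 ^ n" using ok[OF s(1)] s(2) by simp
      then have "v \<in> W n" using s W1 by blast
      then show ?thesis using s(3) by blast
    qed
  qed
  moreover have "V0 \<union> (\<Union>n. W n) \<in> summable_ideal"
    using ideal_on_summable_ideal UW \<open>finite V0\<close> unfolding ideal_on_def by blast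
  ultimately have "{v. \<exists>n. \<exists>s\<in>St n. g s (x n) = enat v} \<in> summable_ideal"
    using ideal_on_summable_ideal unfolding ideal_on_def by blast
  moreover have "strict_mono x" by (simp add: strict_mono_Suc_iff xS)
  ultimately show ?thesis using that[of x St] xS by blast
qed

text \<open>The stems are sums \<open>s\<close> of chosen points, and fusion is applied to the maps
  sending \<open>y\<close> to \<open>f (s + y)\<close>. The limit at \<open>s + z\<close> is close
  to that at \<open>s\<close> because \<open>z + y\<close> eventually stays in the tail of
  \<open>FS E\<close> that controls \<open>s\<close>.\<close>

lemma FS_summable:
  fixes f :: "nat \<Rightarrow> nat"
  shows "\<exists>D. infinite D \<and> f ` FS D \<in> summable_ideal"
proof -
  \<comment> \<open>Deciding all fibres of all shifted maps makes \<open>L s\<close> exist for every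
    \<open>s\<close>.\<close>
  have "countable (range (\<lambda>(s, m). {y. f (s + y) = m}))" by simp
  then obtain E where E: "infinite E"
    "\<And>S. S \<in> range (\<lambda>(s, m). {y. f (s + y) = m}) \<Longrightarrow>
       (\<forall>\<^sub>F y in tail_filter FS E. y \<in> S) \<or> (\<forall>\<^sub>F y in tail_filter FS E. y \<notin> S)"
    using diagonally_Ramsey_decide[OF diagonally_Ramsey_FS infinite_UNIV_nat] by metis
  define F where "F = tail_filter FS E"
  have evF: "eventually P F \<longleftrightarrow> (\<exists>K. finite K \<and> (\<forall>x\<in>FS (E - K). P x))" for P
    by (simp add: F_def eventually_tail_filter[OF mono_FS])
  have F: "F \<noteq> bot"
    unfolding F_def using infinite_FS E(1) by (intro tail_filter_neq_bot[OF mono_FS]) force+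
  have "\<exists>l. limit_along F (\<lambda>y. f (s + y)) l" for s
  proof (rule limit_along_exists)
    fix m
    have "{y. f (s + y) = m} \<in> range (\<lambda>(s, m). {y. f (s + y) = m})"
      by (rule image_eqI[of _ _ "(s, m)"]) auto
    from E(2)[OF this] show "(\<forall>\<^sub>F y in F. f (s + y) = m) \<or> (\<forall>\<^sub>F y in F. f (s + y) \<noteq> m)"
      by (simp add: F_def)
  qed
  then obtain L where L: "\<And>s. limit_along F (\<lambda>y. f (s + y)) (L s)" by metis
  obtain x St where x: "strict_mono x" "range x \<subseteq> E" and St: "St 0 = {0}"
    "\<And>n. St (Suc n) = St n \<union> (\<lambda>s. s + x n) ` St n"
    and sm: "{v. \<exists>n. \<exists>s\<in>St n. enat (f (s + x n)) = enat v} \<in> summable_ideal"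
  proof (rule fusion_summable[OF E(1), of "\<lambda>s y. enat (f (s + y))" L "(+)" 0])
    fix s N
    obtain K where K: "finite K" "\<And>y. y \<in> FS (E - K) \<Longrightarrow> enat (f (s + y)) = L s \<or> enat (f (s + y)) > enat N"
      using limit_along_eventually[OF L, of s N] unfolding evF by blast
    have "L (s + z) = L s \<or> L (s + z) > enat N" if z: "z \<in> E - K" for z
    proof (rule limit_along_close[OF L F])
      obtain M where M: "finite M" "\<And>y. y \<in> FS (E - K - M) \<Longrightarrow> z + y \<in> FS (E - K)"
        using FS_add[OF FS_singleton[OF z]] by metis
      have "E - K - M = E - (K \<union> M)" by blast
      then have "\<forall>\<^sub>F y in F. z + y \<in> FS (E - K)"
        unfolding evF using K(1) M by (intro exI[of _ "K \<union> M"]) simp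
      then show "\<forall>\<^sub>F y in F. enat (f (s + z + y)) = L s \<or> enat (f (s + z + y)) > enat N"
        by (rule eventually_mono) (use K(2) in \<open>simp add: add.assoc\<close>)
    qed
    then show "\<exists>K. finite K \<and> (\<forall>x\<in>E - K. (enat (f (s + x)) = L s \<or> enat (f (s + x)) > enat N) \<and>
        (L (s + x) = L s \<or> L (s + x) > enat N))"
      using K FS_singleton by (intro exI[of _ K]) blast
  qed blast
  have sumSt: "(\<Sum>i\<in>I. x i) \<in> St n" if "I \<subseteq> {..<n}" for I n
    using that
  proof (induction n arbitrary: I)
    case 0
    then show ?case using St(1) by simp
  next
    case (Suc n)
    have I: "I - {n} \<subseteq> {..<n}" "finite I" using Suc.prems finite_subset by (auto simp: less_Suc_eq)
    show ?case
    proof (cases "n \<in> I")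
      case True
      have "(\<Sum>i\<in>I. x i) = (\<Sum>i\<in>I-{n}. x i) + x n"
        using I(2) True by (simp add: sum.remove)
      then show ?thesis using Suc.IH[OF I(1)] St(2) by auto
    next
      case False
      then show ?thesis using Suc.IH[OF I(1)] St(2) by simp
    qed
  qed
  have inj: "inj x" using x(1) strict_mono_imp_inj_on by blast
  have "f ` FS (range x) \<subseteq> {v. \<exists>n. \<exists>s\<in>St n. enat (f (s + x n)) = enat v}"
  proof clarify
    fix y assume "y \<in> FS (range x)"
    then obtain J where J: "finite J" "J \<noteq> {}" "J \<subseteq> range x" "y = \<Sum>J" by (rule FS_E)
    then obtain I where I: "J = x ` I" by (meson subset_imageE)
    have fI: "finite I" using J(1) inj unfolding I by (metis finite_imageD inj_on_subset subset_UNIV)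
    \<comment> \<open>Here the largest index is split off: the other summands form a stem in
      \<open>St n\<close>, and \<open>x n\<close> is the point added to it.\<close>
    define n where "n = Max I"
    have n: "n \<in> I" "I - {n} \<subseteq> {..<n}"
      using fI J(2) I Max_ge[OF fI] by (auto simp: n_def order.strict_iff_order)
    have "y = (\<Sum>i\<in>I. x i)"
      unfolding J(4) I using inj by (subst sum.reindex) (auto simp: inj_on_def)
    also have "\<dots> = (\<Sum>i\<in>I-{n}. x i) + x n" using fI n by (simp add: sum.remove)
    finally show "\<exists>n. \<exists>s\<in>St n. enat (f (s + x n)) = enat (f y)"
      using sumSt[OF n(2)] by auto
  qed
  then have "f ` FS (range x) \<in> summable_ideal"
    by (rule ideal_on_subset[OF ideal_on_summable_ideal sm])
  moreover have "infinite (range x)" using inj by (rule range_inj_infinite)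
  ultimately show ?thesis by blast
qed

text \<open>A stem is \<open>None\<close> until a first coordinate is fixed, and
  \<open>Some a\<close> from then on. \<open>L0\<close> is the limit over pairs and
  \<open>L1 a\<close> the limit along row \<open>a\<close>; fusion controls the row limits by
  \<open>L0\<close> and the values by the row limits.\<close>

lemma ordered_pairs_summable:
  fixes f :: "nat \<Rightarrow> nat \<Rightarrow> nat"
  shows "\<exists>D. infinite D \<and> (\<lambda>(a, b). f a b) ` ordered_pairs D \<in> summable_ideal"
proof -
  \<comment> \<open>The second kind of set reads row \<open>a\<close> off the first coordinate of a
    pair, so that both kinds of limit exist along the same filter.\<close>
  define \<S> where "\<S> = range (\<lambda>m. {(a, b). f a b = m}) \<union> range (\<lambda>(a, m). {(b, c :: nat). f a b = m})"
  have "countable \<S>" by (simp add: \<S>_def)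
  then obtain E where E: "infinite E"
    "\<And>S. S \<in> \<S> \<Longrightarrow> (\<forall>\<^sub>F y in tail_filter ordered_pairs E. y \<in> S) \<or>
       (\<forall>\<^sub>F y in tail_filter ordered_pairs E. y \<notin> S)"
    using diagonally_Ramsey_decide[OF diagonally_Ramsey_ordered_pairs infinite_UNIV_nat] by metis
  define F where "F = tail_filter ordered_pairs E"
  have evF: "eventually P F \<longleftrightarrow> (\<exists>K. finite K \<and> (\<forall>x\<in>ordered_pairs (E - K). P x))" for P
    by (simp add: F_def eventually_tail_filter[OF mono_ordered_pairs])
  have F: "F \<noteq> bot"
    unfolding F_def using ordered_pairs_nonempty E(1) by (rule tail_filter_neq_bot[OF mono_ordered_pairs])
  have "\<exists>l. limit_along F (\<lambda>(b, c). f a b) l" for a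
  proof (rule limit_along_exists)
    fix m
    have "{(b, c). f a b = m} \<in> \<S>"
      unfolding \<S>_def by (rule UnI2, rule image_eqI[of _ _ "(a, m)"]) auto
    from E(2)[OF this] show "(\<forall>\<^sub>F y in F. (case y of (b, c) \<Rightarrow> f a b) = m) \<or>
        (\<forall>\<^sub>F y in F. (case y of (b, c) \<Rightarrow> f a b) \<noteq> m)"
      by (simp add: F_def case_prod_beta)
  qed
  then obtain L1 where L1: "\<And>a. limit_along F (\<lambda>(b, c). f a b) (L1 a)" by metis
  have "\<exists>l. limit_along F (\<lambda>(a, b). f a b) l"
  proof (rule limit_along_exists)
    fix m
    have "{(a, b). f a b = m} \<in> \<S>" by (auto simp: \<S>_def)
    from E(2)[OF this] show "(\<forall>\<^sub>F y in F. (case y of (a, b) \<Rightarrow> f a b) = m) \<or>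
        (\<forall>\<^sub>F y in F. (case y of (a, b) \<Rightarrow> f a b) \<noteq> m)"
      by (simp add: F_def case_prod_beta)
  qed
  then obtain L0 where L0: "limit_along F (\<lambda>(a, b). f a b) L0" by blast
  define L where "L s = (case s of None \<Rightarrow> L0 | Some a \<Rightarrow> L1 a)" for s
  \<comment> \<open>No value is taken before a second coordinate exists, so \<open>None\<close> gets
    \<open>\<infinity>\<close>, which exceeds every \<open>N\<close>. Below, \<open>nxt\<close>
    keeps a first coordinate once it is chosen.\<close>
  define g where "g s b = (case s of None \<Rightarrow> \<infinity> | Some a \<Rightarrow> enat (f a b))" for s b
  define nxt where "nxt s b = (case s of None \<Rightarrow> Some b | Some a \<Rightarrow> Some a)" for s :: "nat option" and b :: nat
  obtain x St where x: "strict_mono x" "range x \<subseteq> E" and St: "St 0 = {None}"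
    "\<And>n. St (Suc n) = St n \<union> (\<lambda>s. nxt s (x n)) ` St n"
    and sm: "{v. \<exists>n. \<exists>s\<in>St n. g s (x n) = enat v} \<in> summable_ideal"
  proof (rule fusion_summable[OF E(1), of g L nxt None])
    fix s N
    show "\<exists>K. finite K \<and> (\<forall>x\<in>E - K. (g s x = L s \<or> g s x > enat N) \<and>
        (L (nxt s x) = L s \<or> L (nxt s x) > enat N))"
    proof (cases s)
      case None
      obtain K where K: "finite K" "\<forall>y\<in>ordered_pairs (E - K).
          enat (case y of (a, b) \<Rightarrow> f a b) = L0 \<or> enat (case y of (a, b) \<Rightarrow> f a b) > enat N"
        using limit_along_eventually[OF L0, of N] unfolding evF by blast
      have "L1 z = L0 \<or> L1 z > enat N" if z: "z \<in> E - K" for z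
      proof (rule limit_along_close[OF L1 F])
        \<comment> \<open>A pair \<open>(b, c)\<close> beyond \<open>z\<close> yields the pair
          \<open>(z, b)\<close>, so row \<open>z\<close> inherits the bound known for pairs.\<close>
        have "(z, b) \<in> ordered_pairs (E - K)" if "(b, c) \<in> ordered_pairs (E - (K \<union> {..z}))" for b c
          using that z by (auto simp: ordered_pairs_def)
        then have "\<forall>\<^sub>F y in F. (z, fst y) \<in> ordered_pairs (E - K)"
          unfolding evF using K(1) by (intro exI[of _ "K \<union> {..z}"]) auto
        then show "\<forall>\<^sub>F y in F. enat (case y of (b, c) \<Rightarrow> f z b) = L0 \<or> enat (case y of (b, c) \<Rightarrow> f z b) > enat N"
          by (rule eventually_mono) (use K(2)[rule_format] in \<open>force simp: case_prod_beta\<close>)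
      qed
      then show ?thesis
        using K(1) None by (intro exI[of _ K]) (simp add: g_def L_def nxt_def)
    next
      case (Some a)
      obtain K where K: "finite K" "\<forall>y\<in>ordered_pairs (E - K).
          enat (case y of (b, c) \<Rightarrow> f a b) = L1 a \<or> enat (case y of (b, c) \<Rightarrow> f a b) > enat N"
        using limit_along_eventually[OF L1, of a N] unfolding evF by blast
      have "enat (f a b) = L1 a \<or> enat (f a b) > enat N" if b: "b \<in> E - K" for b
      proof -
        \<comment> \<open>The filter lives on pairs, so a partner \<open>c\<close> is needed to
          extract a statement about \<open>b\<close> alone.\<close>
        have "infinite {c. (b, c) \<in> ordered_pairs (E - K)}"
          using E(1) K(1) b by (intro ordered_pairs_row) auto
        then obtain c where "(b, c) \<in> ordered_pairs (E - K)"
          using infinite_imp_nonempty by blast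
        then show ?thesis using K(2)[rule_format, of "(b, c)"] by simp
      qed
      then show ?thesis
        using K(1) Some by (intro exI[of _ K]) (simp add: g_def L_def nxt_def)
    qed
  qed blast
  have None: "None \<in> St n" for n by (induction n) (simp_all add: St)
  have inSt: "Some (x i) \<in> St j" if "i < j" for i j
    using that
  proof (induction j)
    case (Suc j)
    show ?case
    proof (cases "i = j")
      case True
      have "nxt None (x j) \<in> (\<lambda>s. nxt s (x j)) ` St j" using None by (rule imageI)
      then show ?thesis using True by (simp add: St nxt_def)
    next
      case False
      then show ?thesis using Suc by (simp add: St)
    qed
  qed simp
  have "(\<lambda>(a, b). f a b) ` ordered_pairs (range x) \<subseteq> {v. \<exists>n. \<exists>s\<in>St n. g s (x n) = enat v}"
  proof clarify
    fix a b assume "(a, b) \<in> ordered_pairs (range x)"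
    then obtain i j where ij: "a = x i" "b = x j" "x i < x j" by (auto simp: ordered_pairs_def)
    then have "i < j" using x(1) by (simp add: strict_mono_less)
    then have "Some a \<in> St j" using inSt ij by simp
    moreover have "g (Some a) (x j) = enat (f a b)" using ij by (simp add: g_def)
    ultimately show "\<exists>n. \<exists>s\<in>St n. g s (x n) = enat (f a b)" by blast
  qed
  then have "(\<lambda>(a, b). f a b) ` ordered_pairs (range x) \<in> summable_ideal"
    by (rule ideal_on_subset[OF ideal_on_summable_ideal sm])
  moreover have "infinite (range x)"
    using x(1) strict_mono_imp_inj_on range_inj_infinite by blast
  ultimately show ?thesis by blast
qed

section \<open>The almost disjoint family under the Continuum Hypothesis\<close>

text \<open>The reals carry their cardinal well-order. A proper initial segment has smaller
  cardinality, so CH rules out that it is uncountable.\<close>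

lemma continuum_hypothesis_well_order:
  assumes continuum_hypothesis
  obtains R :: "(real \<times> real) set" where "wf R" "\<And>a. countable {b. (b, a) \<in> R}"
    "\<And>a b. a \<noteq> b \<Longrightarrow> (a, b) \<in> R \<or> (b, a) \<in> R"
proof
  define r where "r = card_of (UNIV :: real set)"
  have wo: "Well_order r" and co: "Card_order r" and fr: "Field r = UNIV"
    unfolding r_def by (rule card_of_Well_order card_of_Card_order Field_card_of)+
  show "wf (r - Id)" using wo by (simp add: well_order_on_def)
  show "(a, b) \<in> r - Id \<or> (b, a) \<in> r - Id" if "a \<noteq> b" for a b
    using wo that fr by (auto simp: well_order_on_def linear_order_on_def total_on_def)
  show "countable {b. (b, a) \<in> r - Id}" for a
  proof (rule ccontr)
    assume unc: "uncountable {b. (b, a) \<in> r - Id}"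
    moreover have eq: "{b. (b, a) \<in> r - Id} = underS r a" by (auto simp: underS_def)
    ultimately have "underS r a \<approx> (UNIV :: real set)"
      using assms unfolding continuum_hypothesis_def by (metis countable_finite)
    then have "(card_of (underS r a), card_of (UNIV :: real set)) \<in> ordIso"
      using card_of_ordIso unfolding eqpoll_def by blast
    moreover have "(card_of (underS r a), r) \<in> ordLess"
      using card_of_underS[OF co] fr by blast
    ultimately show False unfolding r_def using not_ordLess_ordIso by blast
  qed
qed

text \<open>The tags 0, 1 and 2 keep the graph of the map and the two sets apart inside one set of
  naturals, so the triples inject into the reals. Reals that code no triple of \<open>Q\<close>
  receive a fixed element of \<open>Q\<close>.\<close>

lemma enumerate_by_reals:
  fixes Q :: "((nat \<Rightarrow> nat) \<times> nat set \<times> nat set) set"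
  assumes "Q \<noteq> {}"
  obtains e :: "real \<Rightarrow> (nat \<Rightarrow> nat) \<times> nat set \<times> nat set" where "range e = Q"
proof -
  define j where "j = (\<lambda>(f :: nat \<Rightarrow> nat, D, B). (\<lambda>n. prod_encode (0, prod_encode (n, f n))) ` UNIV \<union>
    (\<lambda>n. prod_encode (1, n)) ` D \<union> (\<lambda>n. prod_encode (2, n)) ` B)"
  have j: "prod_encode (0, prod_encode (n, m)) \<in> j (f, D, B) \<longleftrightarrow> f n = m"
    "prod_encode (1, n) \<in> j (f, D, B) \<longleftrightarrow> n \<in> D"
    "prod_encode (2, n) \<in> j (f, D, B) \<longleftrightarrow> n \<in> B" for f D B n m
    by (auto simp: j_def)
  have "inj j"
  proof (rule injI)
    fix p q assume eq: "j p = j q"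
    obtain f D B where p: "p = (f, D, B)" by (cases p)
    obtain f' D' B' where q: "q = (f', D', B')" by (cases q)
    have "f n = f' n" for n using j(1)[of n "f' n" f D B] j(1)[of n "f' n" f' D' B'] eq p q by simp
    moreover have "n \<in> D \<longleftrightarrow> n \<in> D'" for n using j(2)[of n] eq p q by metis
    moreover have "n \<in> B \<longleftrightarrow> n \<in> B'" for n using j(3)[of n] eq p q by metis
    ultimately show "p = q" using p q by auto
  qed
  moreover obtain k :: "nat set \<Rightarrow> real" where "inj k"
    using nat_sets_eqpoll_reals unfolding eqpoll_def bij_betw_def by blast
  ultimately have inj: "inj (k \<circ> j)" by (rule inj_compose[rotated])
  obtain q where "q \<in> Q" using assms by blast
  define e where "e x = (if x \<in> (k \<circ> j) ` Q then inv_into Q (k \<circ> j) x else q)" for x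
  have "e x \<in> Q" for x using \<open>q \<in> Q\<close> inv_into_into[of x "k \<circ> j" Q] by (simp add: e_def)
  moreover have "e ((k \<circ> j) p) = p" if "p \<in> Q" for p
    using that inj_on_subset[OF inj subset_UNIV, of Q] inv_into_f_f[of "k \<circ> j" Q p] by (simp add: e_def)
  ultimately have "range e = Q" by (metis image_subset_iff rangeI subsetI subset_antisym)
  then show ?thesis by (rule that)
qed

text \<open>Smallness applied to the enumeration of \<open>B\<close> shows that \<open>J\<close> is
  a tall ideal.\<close>

lemma infinite_subset_in_ideal:
  fixes \<rho> :: "nat set \<Rightarrow> nat set"
  assumes "\<And>D. infinite D \<Longrightarrow> infinite (\<rho> D)" "\<And>f :: nat \<Rightarrow> nat. \<exists>D. infinite D \<and> f ` \<rho> D \<in> J"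
    "infinite B"
  obtains A where "A \<subseteq> B" "infinite A" "A \<in> J"
proof -
  obtain D where D: "infinite D" "enumerate B ` \<rho> D \<in> J" using assms(2) by blast
  have "inj (enumerate B)" using assms(3) strict_mono_imp_inj_on strict_mono_enumerate by blast
  then have "infinite (enumerate B ` \<rho> D)"
    using assms(1)[OF D(1)] by (metis finite_imageD inj_on_subset subset_UNIV)
  moreover have "enumerate B ` \<rho> D \<subseteq> B" using assms(3) enumerate_in_set by blast
  ultimately show ?thesis using that D(2) by blast
qed

text \<open>Finitely many sets from \<open>J\<close> cannot cover \<open>B\<close> up to a finite
  set, so an increasing sequence in \<open>B\<close> can avoid more and more members of
  \<open>\<C>\<close>.\<close>

lemma almost_disjoint_selection:
  fixes B :: "nat set"
  assumes J: "ideal_on UNIV J" and B: "B \<notin> J" and C: "countable \<C>" "\<C> \<subseteq> J"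
  obtains A where "A \<subseteq> B" "infinite A" "\<And>C. C \<in> \<C> \<Longrightarrow> finite (A \<inter> C)"
proof -
  \<comment> \<open>Adding the empty set leaves something to enumerate even if \<open>\<C>\<close>
    is empty.\<close>
  define c where "c = from_nat_into (insert {} \<C>)"
  have cr: "range c = insert {} \<C>" unfolding c_def using C(1) by (intro range_from_nat_into) auto
  have "insert {} \<C> \<subseteq> J" using C(2) ideal_on_finite[OF J, of "{}"] by simp
  then have cJ: "c n \<in> J" for n unfolding cr[symmetric] by blast
  have inf: "infinite (B - (\<Union>k\<le>n. c k))" for n
  proof
    assume "finite (B - (\<Union>k\<le>n. c k))"
    then have "B - (\<Union>k\<le>n. c k) \<in> J" by (intro ideal_on_finite[OF J]) auto
    moreover have "(\<Union>k\<le>n. c k) \<in> J" by (intro ideal_on_Union[OF J] cJ) auto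
    ultimately have "(B - (\<Union>k\<le>n. c k)) \<union> (\<Union>k\<le>n. c k) \<in> J" by (rule ideal_on_Un[OF J])
    then show False using ideal_on_subset[OF J] B by blast
  qed
  have "\<exists>b. \<forall>n. b n \<in> B - (\<Union>k\<le>n. c k) \<and> b n < b (Suc n)"
  proof (rule dependent_nat_choice)
    show "\<exists>x. x \<in> B - (\<Union>k\<le>0. c k)" using infinite_imp_nonempty[OF inf] by blast
    show "\<exists>y. y \<in> B - (\<Union>k\<le>Suc n. c k) \<and> x < y" for x n
      using inf[of "Suc n"] unfolding infinite_nat_iff_unbounded by blast
  qed
  then obtain b where b: "\<And>n. b n \<in> B - (\<Union>k\<le>n. c k)" "\<And>n. b n < b (Suc n)" by blast
  have "inj b" using b(2) by (intro strict_mono_imp_inj_on) (simp add: strict_mono_Suc_iff)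
  then have "infinite (range b)" by (rule range_inj_infinite)
  moreover have "finite (range b \<inter> C)" if C: "C \<in> \<C>" for C
  proof -
    have "C \<in> range c" unfolding cr using C by simp
    then obtain k where k: "C = c k" by blast
    have "n < k" if "b n \<in> C" for n
      using b(1)[of n] that k by (metis DiffD2 UN_I atMost_iff not_le)
    then have "range b \<inter> C \<subseteq> b ` {..<k}" by auto
    then show ?thesis by (rule finite_subset) simp
  qed
  moreover have "range b \<subseteq> B" using b(1) by blast
  ultimately show ?thesis using that by blast
qed

text \<open>The alternatives for \<open>f\<close> correspond to its possible limits: an isolated
  point, a member of \<open>\<A>\<close>, or infinity. One recursion serves both convergence,
  through \<open>f\<close> and \<open>D\<close>, and the failure of \<open>FinBW\<close>, through
  \<open>B\<close>.\<close>

lemma almost_disjoint_family_construction: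
  fixes \<rho> :: "nat set \<Rightarrow> nat set"
  assumes CH: continuum_hypothesis and J: "ideal_on UNIV J" and \<rho>: "diagonally_Ramsey \<rho>"
    and inf\<rho>: "\<And>D. infinite D \<Longrightarrow> infinite (\<rho> D)"
    and small: "\<And>f :: nat \<Rightarrow> nat. \<exists>D. infinite D \<and> f ` \<rho> D \<in> J"
  obtains \<A> where "almost_disjoint_family UNIV \<A>" "uncountable \<A>" "\<A> \<subseteq> J"
    "\<And>B. B \<notin> J \<Longrightarrow> \<exists>A\<in>\<A>. A \<subseteq> B"
    "\<And>f :: nat \<Rightarrow> nat. \<And>D. infinite D \<Longrightarrow> f ` \<rho> D \<in> J \<Longrightarrow> \<exists>E. infinite E \<and> \<rho> E \<subseteq> \<rho> D \<and>
       ((\<exists>m. \<forall>\<^sub>F y in tail_filter \<rho> E. f y = m) \<or>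
        (\<forall>N. \<forall>\<^sub>F y in tail_filter \<rho> E. f y > N) \<and>
        ((\<exists>A\<in>\<A>. \<forall>\<^sub>F y in tail_filter \<rho> E. f y \<in> A) \<or> (\<forall>A\<in>\<A>. \<forall>\<^sub>F y in tail_filter \<rho> E. f y \<notin> A)))"
proof -
  obtain R :: "(real \<times> real) set" where R: "wf R" "\<And>a. countable {b. (b, a) \<in> R}"
    "\<And>a b. a \<noteq> b \<Longrightarrow> (a, b) \<in> R \<or> (b, a) \<in> R"
    using continuum_hypothesis_well_order[OF CH] by metis
  define Q where "Q = {(f, D, B). infinite D \<and> f ` \<rho> D \<in> J \<and> B \<notin> J}"
  have UJ: "UNIV \<notin> J" using J by (simp add: ideal_on_def)
  obtain D0 where "infinite D0" "id ` \<rho> D0 \<in> J" using small[of id] by (elim exE conjE)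
  \<comment> \<open>Paired with \<open>id\<close> and \<open>D0\<close>, every positive set occurs
    in a triple; paired with \<open>UNIV\<close>, every admissible map and set do.\<close>
  then have idQ: "(id, D0, UNIV) \<in> Q" using UJ by (simp add: Q_def)
  then have "Q \<noteq> {}" by auto
  then obtain e :: "real \<Rightarrow> _" where e: "range e = Q" by (rule enumerate_by_reals)
  define f where "f a = fst (e a)" for a
  define D where "D a = fst (snd (e a))" for a
  define B where "B a = snd (snd (e a))" for a
  have eQ: "infinite (D a)" "f a ` \<rho> (D a) \<in> J" "B a \<notin> J" for a
  proof -
    have "e a \<in> Q" using e rangeI[of e a] by simp
    then show "infinite (D a)" "f a ` \<rho> (D a) \<in> J" "B a \<notin> J"
      by (auto simp: Q_def f_def D_def B_def)
  qed
  define dec where "dec E S \<longleftrightarrow> (\<forall>\<^sub>F y in tail_filter \<rho> E. y \<in> S) \<or> (\<forall>\<^sub>F y in tail_filter \<rho> E. y \<notin> S)" for E S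
  \<comment> \<open>\<open>z\<close> consists of the new member and of the set found for
    \<open>f a\<close>. The values of \<open>h\<close> enter only below \<open>a\<close>, as
    well-founded choice requires.\<close>
  define stage where "stage h a z \<longleftrightarrow> infinite (snd z) \<and> \<rho> (snd z) \<subseteq> \<rho> (D a) \<and>
      (\<forall>m. dec (snd z) {y. f a y = m}) \<and> (\<forall>b. (b, a) \<in> R \<longrightarrow> dec (snd z) {y. f a y \<in> fst (h b)}) \<and>
      infinite (fst z) \<and> fst z \<in> J \<and> fst z \<subseteq> B a \<and> finite (fst z \<inter> f a ` \<rho> (snd z)) \<and>
      (\<forall>b. (b, a) \<in> R \<longrightarrow> finite (fst z \<inter> fst (h b)) \<and> finite (fst z \<inter> f b ` \<rho> (snd (h b))))"
    for h :: "real \<Rightarrow> nat set \<times> nat set" and a z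
  have "\<exists>h. \<forall>a. stage h a (h a)"
  proof (rule dependent_wf_choice[OF R(1)])
    show "stage h a z = stage h' a z" if "\<And>b. (b, a) \<in> R \<Longrightarrow> h b = h' b" for h h' a z
      using that unfolding stage_def by (auto simp: that)
  next
    fix a h assume h: "\<And>b. (b, a) \<in> R \<Longrightarrow> stage h b (h b)"
    define \<S> where "\<S> = range (\<lambda>m. {y. f a y = m}) \<union> (\<lambda>b. {y. f a y \<in> fst (h b)}) ` {b. (b, a) \<in> R}"
    have "countable \<S>" using R(2) by (simp add: \<S>_def)
    then obtain E where E: "infinite E" "\<rho> E \<subseteq> \<rho> (D a)" "\<And>S. S \<in> \<S> \<Longrightarrow> dec E S"
      using diagonally_Ramsey_decide[OF \<rho> eQ(1)[of a]] unfolding dec_def by metis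
    \<comment> \<open>\<open>E\<close> is fixed before the new member, so its image can join the
      sets to be almost avoided.\<close>
    define \<C> where "\<C> = insert (f a ` \<rho> E) ((\<lambda>b. fst (h b)) ` {b. (b, a) \<in> R} \<union>
      (\<lambda>b. f b ` \<rho> (snd (h b))) ` {b. (b, a) \<in> R})"
    have "countable \<C>" using R(2) by (simp add: \<C>_def)
    moreover have "\<C> \<subseteq> J"
    proof -
      have sub: "f b ` \<rho> X \<in> J" if "\<rho> X \<subseteq> \<rho> (D b)" for b X
        by (rule ideal_on_subset[OF J eQ(2)[of b]]) (use that in \<open>rule image_mono\<close>)
      have "f a ` \<rho> E \<in> J" using E(2) by (rule sub)
      moreover have "fst (h b) \<in> J \<and> f b ` \<rho> (snd (h b)) \<in> J" if "(b, a) \<in> R" for b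
        using h[OF that] sub unfolding stage_def by blast
      ultimately show ?thesis by (auto simp: \<C>_def)
    qed
    ultimately obtain A' where A': "A' \<subseteq> B a" "infinite A'" "\<And>C. C \<in> \<C> \<Longrightarrow> finite (A' \<inter> C)"
      using almost_disjoint_selection[OF J eQ(3)[of a]] by metis
    \<comment> \<open>\<open>A'\<close> need not be in \<open>J\<close>; tallness thins it to a
      member of \<open>J\<close>.\<close>
    obtain A where A: "A \<subseteq> A'" "infinite A" "A \<in> J"
      using infinite_subset_in_ideal[OF inf\<rho> small A'(2)] by metis
    have AC: "finite (A \<inter> C)" if "C \<in> \<C>" for C
      using A'(3)[OF that] A(1) by (meson Int_mono finite_subset subset_refl)
    have "stage h a (A, E)"
      unfolding stage_def fst_conv snd_conv
    proof (intro conjI allI impI)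
      show "dec E {y. f a y = m}" for m by (rule E(3)) (auto simp: \<S>_def)
      show "dec E {y. f a y \<in> fst (h b)}" if "(b, a) \<in> R" for b
        by (rule E(3)) (use that in \<open>auto simp: \<S>_def\<close>)
      show "finite (A \<inter> f a ` \<rho> E)" by (rule AC) (simp add: \<C>_def)
      show "finite (A \<inter> fst (h b))" if "(b, a) \<in> R" for b
        by (rule AC) (use that in \<open>auto simp: \<C>_def\<close>)
      show "finite (A \<inter> f b ` \<rho> (snd (h b)))" if "(b, a) \<in> R" for b
        by (rule AC) (use that in \<open>auto simp: \<C>_def\<close>)
    qed (use E A A' in auto)
    then show "\<exists>z. stage h a z" ..
  qed
  then obtain h where h: "\<And>a. stage h a (h a)" by blast
  define A where "A a = fst (h a)" for a
  define E where "E a = snd (h a)" for a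
  have st: "infinite (E a)" "\<rho> (E a) \<subseteq> \<rho> (D a)" "dec (E a) {y. f a y = m}"
    "(b, a) \<in> R \<Longrightarrow> dec (E a) {y. f a y \<in> A b}" "infinite (A a)" "A a \<in> J" "A a \<subseteq> B a"
    "finite (A a \<inter> f a ` \<rho> (E a))" "(b, a) \<in> R \<Longrightarrow> finite (A a \<inter> A b)"
    "(b, a) \<in> R \<Longrightarrow> finite (A a \<inter> f b ` \<rho> (E b))" for a b m
    using h[of a] unfolding stage_def A_def E_def by simp_all
  have AD: "finite (A a \<inter> A b)" if "a \<noteq> b" for a b
    using R(3)[OF that] st(9)[of a b] st(9)[of b a] by (auto simp: Int_commute)
  show ?thesis
  proof (rule that[of "range A"])
    show "almost_disjoint_family UNIV (range A)"
      unfolding almost_disjoint_family_def using st(5) AD by (metis rangeE subset_UNIV)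
    \<comment> \<open>An infinite set is not almost disjoint from itself, so distinct stages give
      distinct members and the family is as large as the index set.\<close>
    have "inj A"
    proof (rule injI, rule ccontr)
      fix a b assume "A a = A b" "a \<noteq> b"
      then show False using AD[of a b] st(5)[of b] by simp
    qed
    then show "uncountable (range A)"
      using uncountable_UNIV_real by (simp add: countable_image_inj_eq)
    show "range A \<subseteq> J" using st(6) by blast
  next
    fix X assume "X \<notin> J"
    then have "(id, D0, X) \<in> Q" using idQ by (simp add: Q_def)
    then obtain a where "(id, D0, X) = e a" unfolding e[symmetric] by (rule rangeE)
    then have "A a \<subseteq> X" using st(7)[of a] unfolding B_def by (metis snd_conv)
    then show "\<exists>A\<in>range A. A \<subseteq> X" by blast
  next
    fix g :: "nat \<Rightarrow> nat" and X assume "infinite X" "g ` \<rho> X \<in> J"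
    then have "(g, X, UNIV) \<in> Q" using UJ by (simp add: Q_def)
    then obtain a where "(g, X, UNIV) = e a" unfolding e[symmetric] by (rule rangeE)
    then have g: "g = f a" and X: "X = D a" unfolding f_def D_def by (metis fst_conv snd_conv)+
    let ?F = "tail_filter \<rho> (E a)"
    have "(\<forall>\<^sub>F y in ?F. g y = m) \<or> (\<forall>\<^sub>F y in ?F. g y \<noteq> m)" for m
      using st(3)[of a m] by (simp add: dec_def g)
    then have "(\<exists>m. \<forall>\<^sub>F y in ?F. g y = m) \<or> (\<forall>N. \<forall>\<^sub>F y in ?F. g y > N) \<and>
        ((\<exists>A\<in>range A. \<forall>\<^sub>F y in ?F. g y \<in> A) \<or> (\<forall>A\<in>range A. \<forall>\<^sub>F y in ?F. g y \<notin> A))"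
    proof (rule decided_limit)
      fix m assume "\<forall>\<^sub>F y in ?F. g y = m"
      then show ?thesis by blast
    next
      assume esc: "\<And>N. \<forall>\<^sub>F y in ?F. g y > N"
      have "\<forall>\<^sub>F y in ?F. y \<in> \<rho> (E a)"
        using \<rho> eventually_tail_filter[of \<rho>] unfolding diagonally_Ramsey_def
        by (metis Diff_empty finite.emptyI)
      \<comment> \<open>A finite trace on the image is left behind because the values tend to
        infinity.\<close>
      then have later: "\<forall>\<^sub>F y in ?F. g y \<notin> A b" if fin: "finite (A b \<inter> f a ` \<rho> (E a))" for b
      proof -
        obtain N where N: "\<And>v. v \<in> A b \<inter> f a ` \<rho> (E a) \<Longrightarrow> v \<le> N"
          using fin unfolding finite_nat_set_iff_bounded_le by blast
        show ?thesis
          using esc[of N] \<open>\<forall>\<^sub>F y in ?F. y \<in> \<rho> (E a)\<close>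
        proof eventually_elim
          case (elim y)
          then show ?case using N[of "g y"] g by auto
        qed
      qed
      have "(\<exists>A\<in>range A. \<forall>\<^sub>F y in ?F. g y \<in> A) \<or> (\<forall>A\<in>range A. \<forall>\<^sub>F y in ?F. g y \<notin> A)"
      proof (rule disjCI)
        assume no: "\<not> (\<forall>A\<in>range A. \<forall>\<^sub>F y in ?F. g y \<notin> A)"
        then obtain b where b: "\<not> (\<forall>\<^sub>F y in ?F. g y \<notin> A b)" by blast
        \<comment> \<open>The members of stage \<open>a\<close> and of later stages are almost
          disjoint from this image. Only an earlier \<open>b\<close> remains, and the preimage of
          its member was decided at stage \<open>a\<close>.\<close>
        have "b \<noteq> a" using b later st(8)[of a] by blast
        moreover have "(a, b) \<notin> R" using b later st(10)[of a b] by blast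
        ultimately have "(b, a) \<in> R" using R(3) by blast
        then have "\<forall>\<^sub>F y in ?F. g y \<in> A b"
          using st(4)[of b a] b by (simp add: dec_def g)
        then show "\<exists>A\<in>range A. \<forall>\<^sub>F y in ?F. g y \<in> A" by blast
      qed
      then show ?thesis using esc by blast
    qed
    then show "\<exists>E. infinite E \<and> \<rho> E \<subseteq> \<rho> X \<and> ((\<exists>m. \<forall>\<^sub>F y in tail_filter \<rho> E. g y = m) \<or>
        (\<forall>N. \<forall>\<^sub>F y in tail_filter \<rho> E. g y > N) \<and>
        ((\<exists>A\<in>range A. \<forall>\<^sub>F y in tail_filter \<rho> E. g y \<in> A) \<or>
         (\<forall>A\<in>range A. \<forall>\<^sub>F y in tail_filter \<rho> E. g y \<notin> A)))"
      using st(1,2)[of a] X by (intro exI[of _ "E a"]) simp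
  qed
qed

section \<open>Convergence in the compactified Mrowka space\<close>

text \<open>The largest basic neighbourhood of a point. At points of the space these sets are open
  and compact, and they serve to test convergence to infinity.\<close>

fun Psi_nbhd :: "'a + 'a set \<Rightarrow> ('a + 'a set) set" where
  "Psi_nbhd (Inl n) = {Inl n}"
| "Psi_nbhd (Inr A) = insert (Inr A) (Inl ` A)"

context
  fixes \<Lambda> :: "'a set" and \<A> :: "'a set set"
  assumes AD: "almost_disjoint_family \<Lambda> \<A>"
begin

lemma AD_D: "A \<in> \<A> \<Longrightarrow> A \<subseteq> \<Lambda>" "A \<in> \<A> \<Longrightarrow> infinite A"
  "A \<in> \<A> \<Longrightarrow> B \<in> \<A> \<Longrightarrow> A \<noteq> B \<Longrightarrow> finite (A \<inter> B)"
  using AD by (auto simp: almost_disjoint_family_def)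

lemma openin_Psi_Inl: "n \<in> \<Lambda> \<Longrightarrow> openin (Psi \<Lambda> \<A>) {Inl n}"
  by (auto simp: openin_Psi)

lemma openin_Psi_Inr:
  assumes "A \<in> \<A>" "finite F"
  shows "openin (Psi \<Lambda> \<A>) (insert (Inr A) (Inl ` (A - F)))"
  unfolding openin_Psi
proof (intro conjI ballI impI)
  show "insert (Inr A) (Inl ` (A - F)) \<subseteq> Inl ` \<Lambda> \<union> Inr ` \<A>" using assms(1) AD_D(1) by auto
  fix B assume "B \<in> \<A>" "Inr B \<in> insert (Inr A) (Inl ` (A - F))"
  then have "B = A" by auto
  then show "\<exists>F'. finite F' \<and> insert (Inr B) (Inl ` (B - F')) \<subseteq> insert (Inr A) (Inl ` (A - F))"
    using assms(2) by blast
qed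

lemma openin_Psi_nbhd: "i \<in> topspace (Psi \<Lambda> \<A>) \<Longrightarrow> openin (Psi \<Lambda> \<A>) (Psi_nbhd i)"
  using openin_Psi_Inl openin_Psi_Inr[of _ "{}"] by (auto simp: topspace_Psi[OF AD])

text \<open>The member of the cover that contains \<open>Inr A\<close> already contains all but
  finitely many points of \<open>A\<close>.\<close>

lemma compactin_Psi_nbhd:
  assumes i: "i \<in> topspace (Psi \<Lambda> \<A>)"
  shows "compactin (Psi \<Lambda> \<A>) (Psi_nbhd i)"
proof (cases i)
  case (Inl n)
  then show ?thesis using i by simp
next
  case (Inr A)
  have A: "A \<in> \<A>" using i Inr by (auto simp: topspace_Psi[OF AD])
  show ?thesis
    unfolding compactin_def
  proof (intro conjI allI impI)
    show "Psi_nbhd i \<subseteq> topspace (Psi \<Lambda> \<A>)" using openin_Psi_nbhd[OF i] by (rule openin_subset)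
    fix \<U> assume U: "(\<forall>U\<in>\<U>. openin (Psi \<Lambda> \<A>) U) \<and> Psi_nbhd i \<subseteq> \<Union>\<U>"
    then obtain U where U1: "U \<in> \<U>" "Inr A \<in> U" using Inr by auto
    then obtain F where F: "finite F" "insert (Inr A) (Inl ` (A - F)) \<subseteq> U"
      using U A openin_Psi by metis
    have "\<forall>n\<in>A \<inter> F. \<exists>V\<in>\<U>. Inl n \<in> V" using U Inr by auto
    then obtain V where V: "\<And>n. n \<in> A \<inter> F \<Longrightarrow> V n \<in> \<U> \<and> Inl n \<in> V n" by metis
    have "Psi_nbhd i \<subseteq> \<Union>(insert U (V ` (A \<inter> F)))"
    proof
      fix x assume "x \<in> Psi_nbhd i"
      then consider "x = Inr A" | n where "n \<in> A" "x = Inl n" using Inr by auto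
      then show "x \<in> \<Union>(insert U (V ` (A \<inter> F)))"
      proof cases
        case 1
        then show ?thesis using U1 by simp
      next
        case 2
        then show ?thesis using F(2) V[of n] by (cases "n \<in> F") auto
      qed
    qed
    moreover have "finite (insert U (V ` (A \<inter> F)))" using F(1) by simp
    moreover have "insert U (V ` (A \<inter> F)) \<subseteq> \<U>" using U1 V by auto
    ultimately show "\<exists>\<F>. finite \<F> \<and> \<F> \<subseteq> \<U> \<and> Psi_nbhd i \<subseteq> \<Union>\<F>" by blast
  qed
qed

lemma Psi_nbhd_self: "i \<in> Psi_nbhd i"
  by (cases i) auto

text \<open>Through this bound on compact sets, neighbourhoods of infinity are reduced to finitely
  many \<open>Psi_nbhd i\<close>.\<close>

lemma compactin_Psi_cover:
  assumes "compactin (Psi \<Lambda> \<A>) C"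
  obtains I where "finite I" "I \<subseteq> topspace (Psi \<Lambda> \<A>)" "C \<subseteq> (\<Union>i\<in>I. Psi_nbhd i)"
proof -
  have "C \<subseteq> topspace (Psi \<Lambda> \<A>)" using assms by (simp add: compactin_def)
  then have "C \<subseteq> \<Union>(Psi_nbhd ` topspace (Psi \<Lambda> \<A>))" using Psi_nbhd_self by blast
  moreover have "\<forall>U\<in>Psi_nbhd ` topspace (Psi \<Lambda> \<A>). openin (Psi \<Lambda> \<A>) U" using openin_Psi_nbhd by blast
  ultimately obtain \<F> where F: "finite \<F>" "\<F> \<subseteq> Psi_nbhd ` topspace (Psi \<Lambda> \<A>)" "C \<subseteq> \<Union>\<F>"
    using assms unfolding compactin_def by meson
  then obtain I where "I \<subseteq> topspace (Psi \<Lambda> \<A>)" "finite I" "\<F> = Psi_nbhd ` I"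
    using finite_subset_image[OF F(1,2)] by auto
  then show ?thesis using that F(3) by simp
qed

lemma Hausdorff_space_Psi: "Hausdorff_space (Psi \<Lambda> \<A>)"
proof -
  let ?sep = "\<lambda>x y. \<exists>U V. openin (Psi \<Lambda> \<A>) U \<and> openin (Psi \<Lambda> \<A>) V \<and> x \<in> U \<and> y \<in> V \<and> disjnt U V"
  have sym: "?sep x y" if "?sep y x" for x y using that disjnt_sym by metis
  have 1: "?sep (Inl n) (Inl m)" if "n \<in> \<Lambda>" "m \<in> \<Lambda>" "n \<noteq> m" for n m
    using that openin_Psi_Inl by (intro exI[of _ "{Inl n}"] exI[of _ "{Inl m}"]) (auto simp: disjnt_def)
  have 2: "?sep (Inl n) (Inr A)" if "n \<in> \<Lambda>" "A \<in> \<A>" for n A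
    using that openin_Psi_Inl openin_Psi_Inr[of A "{n}"]
    by (intro exI[of _ "{Inl n}"] exI[of _ "insert (Inr A) (Inl ` (A - {n}))"]) (auto simp: disjnt_def)
  \<comment> \<open>Almost disjointness enters here: the finite set \<open>A \<inter> B\<close> is
    removed from both neighbourhoods.\<close>
  have 3: "?sep (Inr A) (Inr B)" if "A \<in> \<A>" "B \<in> \<A>" "A \<noteq> B" for A B
    using that openin_Psi_Inr[of A "A \<inter> B"] openin_Psi_Inr[of B "A \<inter> B"] AD_D(3)
    by (intro exI[of _ "insert (Inr A) (Inl ` (A - A \<inter> B))"]
        exI[of _ "insert (Inr B) (Inl ` (B - A \<inter> B))"]) (auto simp: disjnt_def)
  show ?thesis
    unfolding Hausdorff_space_def topspace_Psi[OF AD]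
  proof (intro allI impI)
    fix x y :: "'a + 'a set"
    assume xy: "x \<in> Inl ` \<Lambda> \<union> Inr ` \<A> \<and> y \<in> Inl ` \<Lambda> \<union> Inr ` \<A> \<and> x \<noteq> y"
    show "?sep x y"
    proof (cases x)
      case x: (Inl n)
      show ?thesis
      proof (cases y)
        case (Inl m)
        show ?thesis unfolding x Inl by (rule 1) (use xy x Inl in auto)
      next
        case (Inr B)
        show ?thesis unfolding x Inr by (rule 2) (use xy x Inr in auto)
      qed
    next
      case x: (Inr A)
      show ?thesis
      proof (cases y)
        case (Inl m)
        show ?thesis unfolding x Inl by (rule sym, rule 2) (use xy x Inl in auto)
      next
        case (Inr B)
        show ?thesis unfolding x Inr by (rule 3) (use xy x Inr in auto)
      qed
    qed
  qed
qed

lemma locally_compact_space_Psi: "locally_compact_space (Psi \<Lambda> \<A>)"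
  unfolding locally_compact_space_def
  using openin_Psi_nbhd compactin_Psi_nbhd Psi_nbhd_self by blast

section \<open>The Alexandroff compactification\<close>

lemma topspace_Phi: "topspace (Phi \<Lambda> \<A>) = insert None (Some ` (Inl ` \<Lambda> \<union> Inr ` \<A>))"
  by (simp add: Phi_def topspace_Psi[OF AD])

lemma Hausdorff_space_Phi: "Hausdorff_space (Phi \<Lambda> \<A>)"
  by (simp add: Phi_def Hausdorff_space_Alexandroff_compactification Hausdorff_space_Psi
      locally_compact_space_Psi)

lemma compact_space_Phi: "compact_space (Phi \<Lambda> \<A>)"
  by (simp add: Phi_def)

lemma openin_Phi_Some:
  assumes "openin (Phi \<Lambda> \<A>) U" "Some x \<in> U"
  obtains V where "openin (Psi \<Lambda> \<A>) V" "x \<in> V" "Some ` V \<subseteq> U"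
proof -
  consider V where "openin (Psi \<Lambda> \<A>) V" "U = Some ` V"
    | C where "closedin (Psi \<Lambda> \<A>) C" "U = insert None (Some ` (topspace (Psi \<Lambda> \<A>) - C))"
    using assms(1) unfolding Phi_def openin_Alexandroff_compactification by blast
  then show ?thesis
  proof cases
    case 1
    then show ?thesis using that assms(2) by blast
  next
    case 2
    then have "openin (Psi \<Lambda> \<A>) (topspace (Psi \<Lambda> \<A>) - C)" by (simp add: closedin_def)
    then show ?thesis using that 2 assms(2) by blast
  qed
qed

lemma openin_Phi_Some_Psi_nbhd:
  "i \<in> topspace (Psi \<Lambda> \<A>) \<Longrightarrow> openin (Phi \<Lambda> \<A>) (Some ` Psi_nbhd i)"
  by (simp add: Phi_def openin_Psi_nbhd)

lemma openin_Phi_Diff_Psi_nbhd: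
  assumes "i \<in> topspace (Psi \<Lambda> \<A>)"
  shows "openin (Phi \<Lambda> \<A>) (insert None (Some ` (topspace (Psi \<Lambda> \<A>) - Psi_nbhd i)))"
  unfolding Phi_def openin_Alexandroff_compactification
  using compactin_Psi_nbhd[OF assms] compactin_imp_closedin[OF Hausdorff_space_Psi] by blast

lemma openin_Phi_None:
  assumes "openin (Phi \<Lambda> \<A>) U" "None \<in> U"
  obtains I where "finite I" "I \<subseteq> topspace (Psi \<Lambda> \<A>)"
    "insert None (Some ` (topspace (Psi \<Lambda> \<A>) - (\<Union>i\<in>I. Psi_nbhd i))) \<subseteq> U"
proof -
  obtain C where C: "compactin (Psi \<Lambda> \<A>) C" "U = insert None (Some ` (topspace (Psi \<Lambda> \<A>) - C))"
    using assms unfolding Phi_def openin_Alexandroff_compactification by blast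
  then show ?thesis using compactin_Psi_cover[OF C(1)] that by (metis Diff_mono image_mono insert_mono subset_refl)
qed

text \<open>A neighbourhood of infinity omits at most finitely many sets \<open>Psi_nbhd i\<close>,
  so it is enough that each of them is eventually left.\<close>

lemma Phi_eventually_None:
  assumes "\<forall>\<^sub>F y in F. \<phi> y \<in> topspace (Phi \<Lambda> \<A>)"
    and "\<And>i. i \<in> topspace (Psi \<Lambda> \<A>) \<Longrightarrow> \<forall>\<^sub>F y in F. \<phi> y \<notin> Some ` Psi_nbhd i"
    and "openin (Phi \<Lambda> \<A>) U" "None \<in> U"
  shows "\<forall>\<^sub>F y in F. \<phi> y \<in> U"
proof -
  obtain I where I: "finite I" "I \<subseteq> topspace (Psi \<Lambda> \<A>)"
    "insert None (Some ` (topspace (Psi \<Lambda> \<A>) - (\<Union>i\<in>I. Psi_nbhd i))) \<subseteq> U"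
    using openin_Phi_None[OF assms(3,4)] by metis
  have "\<forall>\<^sub>F y in F. \<forall>i\<in>I. \<phi> y \<notin> Some ` Psi_nbhd i"
    using I(1,2) assms(2) by (intro eventually_ball_finite) auto
  with assms(1) show ?thesis
  proof eventually_elim
    case (elim y)
    show ?case
    proof (cases "\<phi> y")
      case None
      then show ?thesis using I(3) by simp
    next
      case (Some x)
      then have "x \<in> topspace (Psi \<Lambda> \<A>) - (\<Union>i\<in>I. Psi_nbhd i)"
        using elim by (auto simp: Phi_def)
      then show ?thesis unfolding Some using I(3) by blast
    qed
  qed
qed

lemma Phi_dense:
  assumes "infinite \<A>"
  shows "Phi \<Lambda> \<A> closure_of (Some ` Inl ` \<Lambda>) = topspace (Phi \<Lambda> \<A>)"
proof (intro equalityI closure_of_subset_topspace subsetI)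
  have Inr: "\<exists>y. y \<in> Some ` Inl ` \<Lambda> \<and> y \<in> T"
    if "openin (Phi \<Lambda> \<A>) T" "Some (Inr A) \<in> T" "A \<in> \<A>" for T A
  proof -
    obtain V where V: "openin (Psi \<Lambda> \<A>) V" "Inr A \<in> V" "Some ` V \<subseteq> T"
      using openin_Phi_Some \<open>openin (Phi \<Lambda> \<A>) T\<close> \<open>Some (Inr A) \<in> T\<close> by metis
    then obtain F where F: "finite F" "insert (Inr A) (Inl ` (A - F)) \<subseteq> V"
      using \<open>A \<in> \<A>\<close> unfolding openin_Psi by blast
    have "infinite (A - F)" using AD_D(2)[OF \<open>A \<in> \<A>\<close>] F(1) by simp
    then obtain n where "n \<in> A - F" using infinite_imp_nonempty by blast
    then have "Inl n \<in> V" "n \<in> \<Lambda>" using F(2) AD_D(1)[OF \<open>A \<in> \<A>\<close>] by auto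
    then have "Some (Inl n) \<in> T" "n \<in> \<Lambda>" using V(3) by blast+
    then show ?thesis by blast
  qed
  fix x assume x: "x \<in> topspace (Phi \<Lambda> \<A>)"
  have "\<exists>y. y \<in> Some ` Inl ` \<Lambda> \<and> y \<in> T" if T: "x \<in> T" "openin (Phi \<Lambda> \<A>) T" for T
  proof -
    consider n where "n \<in> \<Lambda>" "x = Some (Inl n)" | A where "A \<in> \<A>" "x = Some (Inr A)" | "x = None"
      using x by (auto simp: topspace_Phi)
    then show ?thesis
    proof cases
      case 1
      then show ?thesis using T by blast
    next
      case 2
      then show ?thesis using T Inr by blast
    next
      case 3
      obtain I where I: "finite I"
        "insert None (Some ` (topspace (Psi \<Lambda> \<A>) - (\<Union>i\<in>I. Psi_nbhd i))) \<subseteq> T"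
        using openin_Phi_None[OF T(2)] T(1) 3 by metis
      \<comment> \<open>Finitely many \<open>i\<close> use up finitely many members of
        \<open>\<A>\<close>. For another member \<open>A\<close>, the point \<open>Inr A\<close>
        lies in no \<open>Psi_nbhd i\<close>, hence \<open>Some (Inr A)\<close> is in
        \<open>T\<close>, and density at such points applies.\<close>
      have "finite (Inr -` I)" using I(1) by (intro finite_vimageI) auto
      then have "infinite (\<A> - Inr -` I)" using assms by simp
      then obtain A where A: "A \<in> \<A> - Inr -` I" using infinite_imp_nonempty by blast
      have "Inr A \<notin> Psi_nbhd i" if "i \<in> I" for i
        using A that by (cases i) auto
      then have "Inr A \<in> topspace (Psi \<Lambda> \<A>) - (\<Union>i\<in>I. Psi_nbhd i)"
        using A by (auto simp: topspace_Psi[OF AD])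
      then have "Some (Inr A) \<in> T" using I(2) by blast
      then show ?thesis using A Inr[OF T(2)] by blast
    qed
  qed
  then show "x \<in> Phi \<Lambda> \<A> closure_of (Some ` Inl ` \<Lambda>)" using x by (simp add: in_closure_of)
qed

lemma separable_space_Phi:
  assumes "infinite \<A>" "countable \<Lambda>"
  shows "separable_space (Phi \<Lambda> \<A>)"
  unfolding separable_space_def
  using Phi_dense[OF assms(1)] assms(2)
  by (intro exI[of _ "Some ` Inl ` \<Lambda>"]) (auto simp: topspace_Phi)

end

section \<open>Cardinality of the space\<close>

lemma continuum_hypothesis_eqpoll:
  assumes continuum_hypothesis "S \<lesssim> (UNIV :: real set)" "uncountable S"
  shows "S \<approx> (UNIV :: real set)"
proof -
  obtain k :: "_ \<Rightarrow> real" where k: "inj_on k S" using assms(2) by (auto simp: lepoll_def)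
  then have "S \<approx> k ` S" by (simp add: inj_on_image_eqpoll_self eqpoll_sym)
  moreover have "uncountable (k ` S)" using assms(3) k by (simp add: countable_image_inj_eq)
  then have "k ` S \<approx> (UNIV :: real set)"
    using assms(1) unfolding continuum_hypothesis_def by (metis countable_finite)
  ultimately show ?thesis by (rule eqpoll_trans)
qed

lemma topspace_Phi_eqpoll:
  fixes \<A> :: "nat set set"
  assumes CH: continuum_hypothesis and AD: "almost_disjoint_family UNIV \<A>" and "uncountable \<A>"
  shows "topspace (Phi UNIV \<A>) \<approx> (UNIV :: real set)"
proof (rule continuum_hypothesis_eqpoll[OF CH])
  \<comment> \<open>0 and 1 encode the kind of point: 0 is missing exactly at isolated points and 1
    exactly at infinity. The data are shifted by 2 to stay clear of them.\<close>
  define j :: "(nat + nat set) option \<Rightarrow> nat set" where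
    "j x = (case x of None \<Rightarrow> {0} | Some (Inl n) \<Rightarrow> {1, n + 2} | Some (Inr A) \<Rightarrow> {0, 1} \<union> (\<lambda>a. a + 2) ` A)" for x
  have tag: "0 \<in> j x \<longleftrightarrow> \<not> (\<exists>n. x = Some (Inl n))" "1 \<in> j x \<longleftrightarrow> x \<noteq> None" for x
    by (auto simp: j_def split: option.splits sum.splits)
  have elem: "m + 2 \<in> j (Some (Inl n)) \<longleftrightarrow> m = n" "m + 2 \<in> j (Some (Inr A)) \<longleftrightarrow> m \<in> A" for m n A
    by (auto simp: j_def)
  have "inj j"
  proof (rule injI)
    fix x y assume eq: "j x = j y"
    consider "x = None" "y = None" | n m where "x = Some (Inl n)" "y = Some (Inl m)"
      | A B where "x = Some (Inr A)" "y = Some (Inr B)"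
      using tag[of x] tag[of y] eq by (cases x; cases y) (metis sum.exhaust option.distinct(1))+
    then show "x = y"
    proof cases
      case 2
      then show ?thesis using elem(1)[of n n] elem(1)[of n m] eq by simp
    next
      case 3
      have "a \<in> A \<longleftrightarrow> a \<in> B" for a using elem(2)[of a A] elem(2)[of a B] eq 3 by simp
      then show ?thesis using 3 by blast
    qed simp
  qed
  moreover obtain k :: "nat set \<Rightarrow> real" where "inj k"
    using nat_sets_eqpoll_reals unfolding eqpoll_def bij_betw_def by blast
  ultimately have "inj (k \<circ> j)" by (rule inj_compose[rotated])
  then show "topspace (Phi UNIV \<A>) \<lesssim> (UNIV :: real set)"
    unfolding lepoll_def by (intro exI[of _ "k \<circ> j"]) (auto intro: inj_on_subset)
  show "uncountable (topspace (Phi UNIV \<A>))"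
  proof
    assume "countable (topspace (Phi UNIV \<A>))"
    moreover have "(\<lambda>A. Some (Inr A)) ` \<A> \<subseteq> topspace (Phi UNIV \<A>)"
      by (auto simp: topspace_Phi[OF AD])
    ultimately have "countable ((\<lambda>A. Some (Inr A) :: (nat + nat set) option) ` \<A>)"
      by (rule countable_subset[rotated])
    then show False using assms(3) by (simp add: countable_image_inj_eq inj_on_def)
  qed
qed

text \<open>The finite part of \<open>A\<close> that a neighbourhood may omit is left behind because
  \<open>g\<close> tends to infinity.\<close>

lemma Phi_eventually_Inr:
  fixes g :: "'l \<Rightarrow> nat"
  assumes "almost_disjoint_family UNIV \<A>" "A \<in> \<A>"
    and "\<forall>\<^sub>F y in F. \<phi> y = Some (Inl (g y))" "\<forall>\<^sub>F y in F. g y \<in> A" "\<And>N. \<forall>\<^sub>F y in F. g y > N"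
    and "openin (Phi UNIV \<A>) U" "Some (Inr A) \<in> U"
  shows "\<forall>\<^sub>F y in F. \<phi> y \<in> U"
proof -
  obtain V where V: "openin (Psi UNIV \<A>) V" "Inr A \<in> V" "Some ` V \<subseteq> U"
    using openin_Phi_Some[OF assms(1,6,7)] by metis
  then obtain K where K: "finite K" "insert (Inr A) (Inl ` (A - K)) \<subseteq> V"
    using assms(2) unfolding openin_Psi by blast
  obtain N where N: "\<And>k. k \<in> K \<Longrightarrow> k \<le> N" using K(1) unfolding finite_nat_set_iff_bounded_le by blast
  show ?thesis
    using assms(3,4) assms(5)[of N]
  proof eventually_elim
    case (elim y)
    then have "g y \<notin> K" using N[of "g y"] by auto
    then have "Inl (g y) \<in> V" using K(2) elim by auto
    then show ?case using V(3) elim by auto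
  qed
qed

text \<open>The values of \<open>f\<close> range over the whole space. If they are eventually
  isolated points, \<open>lim\<close> applies. If they are eventually non-isolated and no value is
  eventually constant, they tend to infinity, since \<open>Psi_nbhd i\<close> contains no
  non-isolated point except possibly \<open>i\<close>.\<close>

lemma Phi_subsequence:
  fixes \<rho> :: "nat set \<Rightarrow> nat set" and f :: "nat \<Rightarrow> (nat + nat set) option"
  assumes AD: "almost_disjoint_family UNIV \<A>" and \<rho>: "diagonally_Ramsey \<rho>" and J: "ideal_on UNIV J"
    and small: "\<And>f :: nat \<Rightarrow> nat. \<exists>D. infinite D \<and> f ` \<rho> D \<in> J"
    and lim: "\<And>g :: nat \<Rightarrow> nat. \<And>D. infinite D \<Longrightarrow> g ` \<rho> D \<in> J \<Longrightarrow> \<exists>E. infinite E \<and> \<rho> E \<subseteq> \<rho> D \<and>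
       ((\<exists>m. \<forall>\<^sub>F y in tail_filter \<rho> E. g y = m) \<or>
        (\<forall>N. \<forall>\<^sub>F y in tail_filter \<rho> E. g y > N) \<and>
        ((\<exists>A\<in>\<A>. \<forall>\<^sub>F y in tail_filter \<rho> E. g y \<in> A) \<or> (\<forall>A\<in>\<A>. \<forall>\<^sub>F y in tail_filter \<rho> E. g y \<notin> A)))"
    and f: "\<And>y. f y \<in> topspace (Phi UNIV \<A>)"
  shows "\<exists>D x. infinite D \<and> x \<in> topspace (Phi UNIV \<A>) \<and>
    (\<forall>U. openin (Phi UNIV \<A>) U \<and> x \<in> U \<longrightarrow> (\<forall>\<^sub>F y in tail_filter \<rho> D. f y \<in> U))"
proof -
  have mono: "mono \<rho>" using \<rho> by (simp add: diagonally_Ramsey_def)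
  note tail = eventually_tail_filter[OF mono]
  \<comment> \<open>The default 0 makes \<open>g\<close> total; conclusions about \<open>f\<close>
    are drawn from it only on \<open>P\<close>.\<close>
  define g where "g y = (case f y of Some (Inl n) \<Rightarrow> n | _ \<Rightarrow> 0)" for y
  \<comment> \<open>Smallness of the image comes first, since it survives every later
    shrinking.\<close>
  obtain D0 where D0: "infinite D0" "g ` \<rho> D0 \<in> J" using small[of g] by (elim exE conjE)
  define P where "P = f -` Some ` range Inl"
  have fP: "f y = Some (Inl (g y))" if "y \<in> P" for y
    using that by (auto simp: P_def g_def)
  \<comment> \<open>The domain of \<open>f\<close> is countable, so its nonempty fibres can all be
    decided together with \<open>P\<close>.\<close>
  have "countable (insert P (range (\<lambda>z. f -` {f z})))" by simp
  then obtain D1 where D1: "infinite D1" "\<rho> D1 \<subseteq> \<rho> D0"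
    and dec: "\<And>S. S \<in> insert P (range (\<lambda>z. f -` {f z})) \<Longrightarrow>
      (\<forall>\<^sub>F y in tail_filter \<rho> D1. y \<in> S) \<or> (\<forall>\<^sub>F y in tail_filter \<rho> D1. y \<notin> S)"
    using diagonally_Ramsey_decide[OF \<rho> D0(1)] by metis
  consider z where "\<forall>\<^sub>F y in tail_filter \<rho> D1. f y = f z"
    | "\<forall>\<^sub>F y in tail_filter \<rho> D1. y \<in> P"
    | "\<And>z. \<forall>\<^sub>F y in tail_filter \<rho> D1. f y \<noteq> f z" "\<forall>\<^sub>F y in tail_filter \<rho> D1. y \<notin> P"
  proof -
    have "(\<forall>\<^sub>F y in tail_filter \<rho> D1. f y = f z) \<or> (\<forall>\<^sub>F y in tail_filter \<rho> D1. f y \<noteq> f z)" for z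
      using dec[of "f -` {f z}"] by simp
    then show thesis using that dec[of P] by blast
  qed
  then show ?thesis
  proof cases
    case (1 z)
    have "\<forall>\<^sub>F y in tail_filter \<rho> D1. f y \<in> U" if "f z \<in> U" for U
      using 1 by (rule eventually_mono) (use that in simp)
    then show ?thesis using D1(1) f by blast
  next
    case 2
    then obtain K where K: "finite K" "\<rho> (D1 - K) \<subseteq> P" unfolding tail by blast
    have sub: "\<rho> (D1 - K) \<subseteq> \<rho> D0" using monoD[OF mono, of "D1 - K" D1] D1(2) by blast
    have gJ: "g ` \<rho> (D1 - K) \<in> J" by (rule ideal_on_subset[OF J D0(2)]) (use sub in \<open>rule image_mono\<close>)
    have "infinite (D1 - K)" using D1(1) K(1) by simp
    from lim[OF this gJ] obtain E where E: "infinite E" "\<rho> E \<subseteq> \<rho> (D1 - K)"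
      "(\<exists>m. \<forall>\<^sub>F y in tail_filter \<rho> E. g y = m) \<or>
        (\<forall>N. \<forall>\<^sub>F y in tail_filter \<rho> E. g y > N) \<and>
        ((\<exists>A\<in>\<A>. \<forall>\<^sub>F y in tail_filter \<rho> E. g y \<in> A) \<or> (\<forall>A\<in>\<A>. \<forall>\<^sub>F y in tail_filter \<rho> E. g y \<notin> A))"
      by (elim exE conjE)
    have "\<forall>y\<in>\<rho> (E - {}). f y = Some (Inl (g y))" using E(2) K(2) fP by auto
    then have fg: "\<forall>\<^sub>F y in tail_filter \<rho> E. f y = Some (Inl (g y))"
      unfolding tail using finite.emptyI by blast
    consider m where "\<forall>\<^sub>F y in tail_filter \<rho> E. g y = m"
      | A where "\<And>N. \<forall>\<^sub>F y in tail_filter \<rho> E. g y > N" "A \<in> \<A>" "\<forall>\<^sub>F y in tail_filter \<rho> E. g y \<in> A"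
      | "\<And>N. \<forall>\<^sub>F y in tail_filter \<rho> E. g y > N" "\<And>A. A \<in> \<A> \<Longrightarrow> \<forall>\<^sub>F y in tail_filter \<rho> E. g y \<notin> A"
      using E(3) by blast
    then show ?thesis
    proof cases
      case (1 m)
      have "\<forall>\<^sub>F y in tail_filter \<rho> E. f y \<in> U" if "Some (Inl m) \<in> U" for U
        using 1 fg by eventually_elim (use that in simp)
      moreover have "Some (Inl m) \<in> topspace (Phi UNIV \<A>)" by (simp add: topspace_Phi[OF AD])
      ultimately show ?thesis using E(1) by blast
    next
      case (2 A)
      have "\<forall>\<^sub>F y in tail_filter \<rho> E. f y \<in> U" if "openin (Phi UNIV \<A>) U" "Some (Inr A) \<in> U" for U
        using Phi_eventually_Inr[OF AD 2(2) fg 2(3,1) that] .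
      moreover have "Some (Inr A) \<in> topspace (Phi UNIV \<A>)" using 2(2) by (simp add: topspace_Phi[OF AD])
      ultimately show ?thesis using E(1) by blast
    next
      case 3
      have nb: "\<forall>\<^sub>F y in tail_filter \<rho> E. f y \<notin> Some ` Psi_nbhd i" if i: "i \<in> topspace (Psi UNIV \<A>)" for i
      proof (cases i)
        case (Inl n)
        show ?thesis
          using 3(1)[of n] fg by eventually_elim (use Inl in auto)
      next
        case (Inr A)
        then have "A \<in> \<A>" using i by (auto simp: topspace_Psi[OF AD])
        show ?thesis
          using 3(2)[OF \<open>A \<in> \<A>\<close>] fg by eventually_elim (use Inr in auto)
      qed
      have "\<forall>\<^sub>F y in tail_filter \<rho> E. f y \<in> U" if "openin (Phi UNIV \<A>) U" "None \<in> U" for U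
        by (rule Phi_eventually_None[OF AD _ nb that]) (simp add: f)
      moreover have "None \<in> topspace (Phi UNIV \<A>)" by (simp add: topspace_Phi[OF AD])
      ultimately show ?thesis using E(1) by blast
    qed
  next
    case 3
    have nb: "\<forall>\<^sub>F y in tail_filter \<rho> D1. f y \<notin> Some ` Psi_nbhd i" for i
    proof -
      have ne: "\<forall>\<^sub>F y in tail_filter \<rho> D1. f y \<noteq> Some i"
      proof (cases "Some i \<in> range f")
        case True
        then obtain z where "Some i = f z" by blast
        then show ?thesis using 3(1)[of z] by simp
      next
        case False
        then have "f y \<noteq> Some i" for y by (metis rangeI)
        then show ?thesis by simp
      qed
      have "f y \<notin> Some ` Psi_nbhd i" if "f y \<noteq> Some i" "y \<notin> P" for y
        using that by (cases i) (auto simp: P_def)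
      then show ?thesis by (rule eventually_elim2[OF ne 3(2)])
    qed
    have "\<forall>\<^sub>F y in tail_filter \<rho> D1. f y \<in> U" if "openin (Phi UNIV \<A>) U" "None \<in> U" for U
      by (rule Phi_eventually_None[OF AD _ nb that]) (simp add: f)
    moreover have "None \<in> topspace (Phi UNIV \<A>)" by (simp add: topspace_Phi[OF AD])
    ultimately show ?thesis using D1(1) by blast
  qed
qed

text \<open>The test map is the inclusion of the isolated points, read through \<open>c\<close>. A
  limit \<open>Some i\<close> would put a positive set almost inside the trace of
  \<open>Psi_nbhd i\<close>, which is small; a limit at infinity is refuted by a member of
  \<open>\<A>\<close> inside the positive set.\<close>

lemma Phi_notin_FinBW:
  fixes \<A> :: "nat set set" and c :: "nat \<Rightarrow> 'a"
  assumes AD: "almost_disjoint_family UNIV \<A>" and I: "ideal_on \<Lambda> \<I>" and c: "bij_betw c UNIV \<Lambda>"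
    and AI: "\<And>A. A \<in> \<A> \<Longrightarrow> c ` A \<in> \<I>" and pos: "\<And>B. c ` B \<notin> \<I> \<Longrightarrow> \<exists>A\<in>\<A>. A \<subseteq> B"
  shows "Phi UNIV \<A> \<notin> FinBW \<Lambda> \<I>"
proof
  assume BW: "Phi UNIV \<A> \<in> FinBW \<Lambda> \<I>"
  have inj: "inj c" and ran: "range c = \<Lambda>" using c by (auto simp: bij_betw_def)
  define f :: "'a \<Rightarrow> (nat + nat set) option" where "f a = Some (Inl (inv c a))" for a
  have fc: "f (c n) = Some (Inl n)" for n using inj by (simp add: f_def)
  have "f \<in> \<Lambda> \<rightarrow> topspace (Phi UNIV \<A>)" by (auto simp: topspace_Phi[OF AD] f_def)
  from BW[unfolded FinBW_def mem_Collect_eq, THEN spec, THEN mp, OF this]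
  obtain X x where X: "X \<in> positive_sets \<Lambda> \<I>" "x \<in> topspace (Phi UNIV \<A>)"
    and conv: "\<And>U. openin (Phi UNIV \<A>) U \<Longrightarrow> x \<in> U \<Longrightarrow> finite {a \<in> X. f a \<notin> U}"
    by blast
  define S where "S = c -` X"
  have XS: "X = c ` S" using X(1) ran by (auto simp: positive_sets_def S_def)
  have SI: "c ` S \<notin> \<I>" using X(1) XS by (simp add: positive_sets_def)
  have bad: "infinite (S - T)" if T: "c ` T \<in> \<I>" for T
  proof
    assume "finite (S - T)"
    then have "c ` (S - T) \<in> \<I>" using ran by (intro ideal_on_finite[OF I]) auto
    then have "c ` (S - T) \<union> c ` T \<in> \<I>" using T by (rule ideal_on_Un[OF I])
    then have "c ` S \<in> \<I>" by (rule ideal_on_subset[OF I]) blast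
    then show False using SI by blast
  qed
  have fin: "finite {n \<in> S. Some (Inl n) \<notin> U}" if U: "openin (Phi UNIV \<A>) U" "x \<in> U" for U
  proof -
    have "c ` {n \<in> S. Some (Inl n) \<notin> U} \<subseteq> {a \<in> X. f a \<notin> U}" using fc XS by auto
    then have "finite (c ` {n \<in> S. Some (Inl n) \<notin> U})" using conv[OF U] finite_subset by blast
    then show ?thesis by (rule finite_imageD) (rule inj_on_subset[OF inj subset_UNIV])
  qed
  consider i where "i \<in> topspace (Psi UNIV \<A>)" "x = Some i" | "x = None"
    using X(2) by (auto simp: Phi_def)
  then show False
  proof cases
    case (1 i)
    define T where "T = {n. Inl n \<in> Psi_nbhd i}"
    have "c ` T \<in> \<I>"
    proof (cases i)
      case (Inl n)
      then have "T = {n}" by (auto simp: T_def)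
      then show ?thesis using ran by (intro ideal_on_finite[OF I]) auto
    next
      case (Inr A)
      then have "T = A" "A \<in> \<A>" using 1 by (auto simp: T_def topspace_Psi[OF AD])
      then show ?thesis using AI by simp
    qed
    then have "infinite (S - T)" by (rule bad)
    moreover have "S - T = {n \<in> S. Some (Inl n) \<notin> Some ` Psi_nbhd i}" by (auto simp: T_def)
    moreover have "x \<in> Some ` Psi_nbhd i" using 1(2) Psi_nbhd_self[OF AD] by blast
    ultimately show False using fin[OF openin_Phi_Some_Psi_nbhd[OF AD 1(1)]] by simp
  next
    case 2
    obtain A where A: "A \<in> \<A>" "A \<subseteq> S" using pos[OF SI] by blast
    then have "Inr A \<in> topspace (Psi UNIV \<A>)" by (simp add: topspace_Psi[OF AD])
    \<comment> \<open>Removing the compact set \<open>Psi_nbhd (Inr A)\<close> leaves a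
      neighbourhood of infinity that misses all of the infinite set \<open>A\<close>.\<close>
    from fin[OF openin_Phi_Diff_Psi_nbhd[OF AD this]]
    have "finite {n \<in> S. Some (Inl n) \<notin> insert None (Some ` (topspace (Psi UNIV \<A>) - Psi_nbhd (Inr A)))}"
      using 2 by simp
    moreover have "A \<subseteq> {n \<in> S. Some (Inl n) \<notin> insert None (Some ` (topspace (Psi UNIV \<A>) - Psi_nbhd (Inr A)))}"
      using A(2) by auto
    ultimately show False using AD_D(2)[OF AD A(1)] finite_subset by blast
  qed
qed

text \<open>The ideal is carried to the naturals along a bijection \<open>c\<close>; the family is
  built there, and failure of \<open>FinBW\<close> is read back on \<open>\<Lambda>\<close>.\<close>

lemma Phi_space_exists:
  fixes \<rho> :: "nat set \<Rightarrow> nat set" and \<Lambda> :: "'a set"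
  assumes CH: continuum_hypothesis and \<Lambda>: "countable \<Lambda>" "infinite \<Lambda>" and I: "ideal_on \<Lambda> \<I>"
    and \<rho>: "diagonally_Ramsey \<rho>" and inf\<rho>: "\<And>D. infinite D \<Longrightarrow> infinite (\<rho> D)"
    and small: "\<And>\<phi> :: nat \<Rightarrow> 'a. range \<phi> \<subseteq> \<Lambda> \<Longrightarrow> \<exists>D. infinite D \<and> \<phi> ` \<rho> D \<in> \<I>"
  obtains \<A> :: "nat set set" where "almost_disjoint_family UNIV \<A>" "infinite \<A>"
    "Hausdorff_space (Phi UNIV \<A>)" "compact_space (Phi UNIV \<A>)" "separable_space (Phi UNIV \<A>)"
    "topspace (Phi UNIV \<A>) \<approx> (UNIV :: real set)" "Phi UNIV \<A> \<notin> FinBW \<Lambda> \<I>"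
    "\<forall>f. f \<in> UNIV \<rightarrow> topspace (Phi UNIV \<A>) \<longrightarrow> (\<exists>D x. infinite D \<and> x \<in> topspace (Phi UNIV \<A>) \<and>
       (\<forall>U. openin (Phi UNIV \<A>) U \<and> x \<in> U \<longrightarrow> (\<exists>K. finite K \<and> f ` \<rho> (D - K) \<subseteq> U)))"
proof -
  define c where "c = from_nat_into \<Lambda>"
  have c: "bij_betw c UNIV \<Lambda>" unfolding c_def using \<Lambda> by (rule bij_betw_from_nat_into)
  then have ran: "range c = \<Lambda>" and inj: "inj c" by (auto simp: bij_betw_def)
  define J where "J = {S. c ` S \<in> \<I>}"
  have J: "ideal_on UNIV J"
    unfolding ideal_on_def
  proof (intro conjI ballI allI impI)
    show "B \<in> J" if "A \<in> J" "B \<subseteq> A" for A B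
      using that ideal_on_subset[OF I, of "c ` A" "c ` B"] by (auto simp: J_def)
    show "A \<union> B \<in> J" if "A \<in> J" "B \<in> J" for A B
      using that ideal_on_Un[OF I] by (simp add: J_def image_Un)
    show fin: "F \<in> J" if "finite F \<and> F \<subseteq> UNIV" for F
      using that ran ideal_on_finite[OF I, of "c ` F"] by (auto simp: J_def)
    show "J \<noteq> {}" using fin[of "{}"] by auto
    show "UNIV \<notin> J" using I by (simp add: J_def ran ideal_on_def)
  qed simp
  have smallJ: "\<exists>D. infinite D \<and> g ` \<rho> D \<in> J" for g :: "nat \<Rightarrow> nat"
  proof -
    have "range (c \<circ> g) \<subseteq> \<Lambda>" using ran by auto
    then show ?thesis using small[of "c \<circ> g"] by (simp add: J_def image_comp)
  qed
  obtain \<A> where AD: "almost_disjoint_family UNIV \<A>" and unc: "uncountable \<A>" and AJ: "\<A> \<subseteq> J"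
    and pos: "\<And>B. B \<notin> J \<Longrightarrow> \<exists>A\<in>\<A>. A \<subseteq> B"
    and lim: "\<And>g :: nat \<Rightarrow> nat. \<And>D. infinite D \<Longrightarrow> g ` \<rho> D \<in> J \<Longrightarrow> \<exists>E. infinite E \<and> \<rho> E \<subseteq> \<rho> D \<and>
       ((\<exists>m. \<forall>\<^sub>F y in tail_filter \<rho> E. g y = m) \<or>
        (\<forall>N. \<forall>\<^sub>F y in tail_filter \<rho> E. g y > N) \<and>
        ((\<exists>A\<in>\<A>. \<forall>\<^sub>F y in tail_filter \<rho> E. g y \<in> A) \<or> (\<forall>A\<in>\<A>. \<forall>\<^sub>F y in tail_filter \<rho> E. g y \<notin> A)))"
    using almost_disjoint_family_construction[OF CH J \<rho> inf\<rho> smallJ] by blast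
  have infA: "infinite \<A>" using unc countable_finite by blast
  show ?thesis
  proof (rule that[of \<A>])
    show "Phi UNIV \<A> \<notin> FinBW \<Lambda> \<I>"
      using AJ pos by (intro Phi_notin_FinBW[OF AD I c]) (auto simp: J_def)
    have mono: "mono \<rho>" using \<rho> by (simp add: diagonally_Ramsey_def)
    show "\<forall>f. f \<in> UNIV \<rightarrow> topspace (Phi UNIV \<A>) \<longrightarrow> (\<exists>D x. infinite D \<and> x \<in> topspace (Phi UNIV \<A>) \<and>
       (\<forall>U. openin (Phi UNIV \<A>) U \<and> x \<in> U \<longrightarrow> (\<exists>K. finite K \<and> f ` \<rho> (D - K) \<subseteq> U)))"
    proof (intro allI impI)
      fix f :: "nat \<Rightarrow> (nat + nat set) option" assume "f \<in> UNIV \<rightarrow> topspace (Phi UNIV \<A>)"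
      then have f: "f y \<in> topspace (Phi UNIV \<A>)" for y by blast
      show "\<exists>D x. infinite D \<and> x \<in> topspace (Phi UNIV \<A>) \<and>
         (\<forall>U. openin (Phi UNIV \<A>) U \<and> x \<in> U \<longrightarrow> (\<exists>K. finite K \<and> f ` \<rho> (D - K) \<subseteq> U))"
        using Phi_subsequence[OF AD \<rho> J smallJ lim f]
        unfolding eventually_tail_filter[OF mono] image_subset_iff .
    qed
  qed (rule AD infA Hausdorff_space_Phi[OF AD] compact_space_Phi[OF AD]
      separable_space_Phi[OF AD infA] topspace_Phi_eqpoll[OF CH AD unc] countableI_type)+
qed

section \<open>Hindman, Ramsey and differentially compact spaces\<close>

text \<open>As \<open>\<phi>\<close> is no reduction, some \<open>A\<close> outside the ideal on
  \<open>P\<close> has its image in \<open>\<I>\<close>, and such an \<open>A\<close> contains some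
  \<open>\<rho> D\<close>. Leaving \<open>P\<close> and \<open>\<rho>\<close> open covers all three
  ideals.\<close>

lemma not_katetov_le_small_image:
  assumes "\<not> katetov_le \<Lambda> \<I> P {A. A \<subseteq> P \<and> (\<forall>D. infinite D \<longrightarrow> \<not> \<rho> D \<subseteq> A)}"
    and "ideal_on \<Lambda> \<I>" "\<phi> \<in> P \<rightarrow> \<Lambda>"
  shows "\<exists>D. infinite D \<and> \<phi> ` \<rho> D \<in> \<I>"
proof -
  obtain A D where A: "\<phi> ` A \<in> \<I>" and D: "infinite D" "\<rho> D \<subseteq> A"
    using assms(1,3) unfolding katetov_le_def by blast
  have "\<phi> ` \<rho> D \<in> \<I>"
    by (rule ideal_on_subset[OF assms(2) A]) (use D(2) in \<open>rule image_mono\<close>)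
  then show ?thesis using D(1) by blast
qed

lemma Hindman_ideal_eq: "Hindman_ideal = {A. A \<subseteq> UNIV \<and> (\<forall>D. infinite D \<longrightarrow> \<not> FS D \<subseteq> A)}"
  by (simp add: Hindman_ideal_def)

lemma Delta_ideal_eq: "Delta_ideal = {A. A \<subseteq> UNIV \<and> (\<forall>D. infinite D \<longrightarrow> \<not> Delta D \<subseteq> A)}"
  by (simp add: Delta_ideal_def)

section \<open>Differences and unordered pairs as images of increasing pairs\<close>

lemma Delta_eq_image: "Delta D = (\<lambda>(a, b). b - a) ` ordered_pairs D"
  unfolding Delta_def ordered_pairs_def by (auto simp: image_iff)

lemma nsets_2_eq_image:
  fixes D :: "nat set"
  shows "[D]\<^bsup>2\<^esup> = (\<lambda>(a, b). {a, b}) ` ordered_pairs D"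
proof
  show "[D]\<^bsup>2\<^esup> \<subseteq> (\<lambda>(a, b). {a, b}) ` ordered_pairs D"
  proof
    fix e assume "e \<in> [D]\<^bsup>2\<^esup>"
    then obtain x y where e: "e = {x, y}" "x \<in> D" "y \<in> D" "x \<noteq> y" by (rule nsets2_E)
    then have "(min x y, max x y) \<in> ordered_pairs D" "e = {min x y, max x y}"
      by (auto simp: ordered_pairs_def min_def max_def)
    then show "e \<in> (\<lambda>(a, b). {a, b}) ` ordered_pairs D" by (auto simp: image_iff)
  qed
qed (auto simp: ordered_pairs_def)

text \<open>The differences from one fixed element are already pairwise distinct.\<close>

lemma infinite_Delta:
  assumes "infinite D"
  shows "infinite (Delta D)"
proof -
  obtain a where a: "a \<in> D" using infinite_imp_nonempty[OF assms] by blast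
  have "inj_on (\<lambda>b. b - a) {b. (a, b) \<in> ordered_pairs D}"
    by (auto simp: inj_on_def ordered_pairs_def)
  then have "infinite ((\<lambda>b. b - a) ` {b. (a, b) \<in> ordered_pairs D})"
    using ordered_pairs_row[OF assms a] finite_imageD by blast
  moreover have "(\<lambda>b. b - a) ` {b. (a, b) \<in> ordered_pairs D} \<subseteq> Delta D"
    by (auto simp: Delta_eq_image image_iff)
  ultimately show ?thesis by (rule infinite_super[rotated])
qed

lemma Hindman_space_exists:
  fixes \<Lambda> :: "'a set"
  assumes "continuum_hypothesis" "countable \<Lambda>" "infinite \<Lambda>" "ideal_on \<Lambda> \<I>"
    and "\<And>\<phi>. \<phi> \<in> UNIV \<rightarrow> \<Lambda> \<Longrightarrow> \<exists>D. infinite D \<and> \<phi> ` FS D \<in> \<I>"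
  shows "\<exists>\<A> :: nat set set. almost_disjoint_family UNIV \<A> \<and> infinite \<A> \<and>
    Hausdorff_space (Phi UNIV \<A>) \<and> compact_space (Phi UNIV \<A>) \<and>
    separable_space (Phi UNIV \<A>) \<and> topspace (Phi UNIV \<A>) \<approx> (UNIV :: real set) \<and>
    Hindman_space (Phi UNIV \<A>) \<and> Phi UNIV \<A> \<notin> FinBW \<Lambda> \<I>"
proof -
  have small: "\<exists>D. infinite D \<and> \<phi> ` FS D \<in> \<I>" if "range \<phi> \<subseteq> \<Lambda>" for \<phi>
    using that by (intro assms(5)) auto
  obtain \<A> :: "nat set set" where "almost_disjoint_family UNIV \<A>" "infinite \<A>"
    "Hausdorff_space (Phi UNIV \<A>)" "compact_space (Phi UNIV \<A>)" "separable_space (Phi UNIV \<A>)"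
    "topspace (Phi UNIV \<A>) \<approx> (UNIV :: real set)" "Phi UNIV \<A> \<notin> FinBW \<Lambda> \<I>"
    "\<forall>f. f \<in> UNIV \<rightarrow> topspace (Phi UNIV \<A>) \<longrightarrow> (\<exists>D x. infinite D \<and> x \<in> topspace (Phi UNIV \<A>) \<and>
       (\<forall>U. openin (Phi UNIV \<A>) U \<and> x \<in> U \<longrightarrow> (\<exists>K. finite K \<and> f ` FS (D - K) \<subseteq> U)))"
    by (rule Phi_space_exists[OF assms(1-4) diagonally_Ramsey_FS infinite_FS small])
  then show ?thesis unfolding Hindman_space_def by (intro exI[of _ \<A>]) simp
qed

lemma differentially_compact_space_exists:
  fixes \<Lambda> :: "'a set"
  assumes "continuum_hypothesis" "countable \<Lambda>" "infinite \<Lambda>" "ideal_on \<Lambda> \<I>"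
    and "\<And>\<phi>. \<phi> \<in> UNIV \<rightarrow> \<Lambda> \<Longrightarrow> \<exists>D. infinite D \<and> \<phi> ` Delta D \<in> \<I>"
  shows "\<exists>\<A> :: nat set set. almost_disjoint_family UNIV \<A> \<and> infinite \<A> \<and>
    Hausdorff_space (Phi UNIV \<A>) \<and> compact_space (Phi UNIV \<A>) \<and>
    separable_space (Phi UNIV \<A>) \<and> topspace (Phi UNIV \<A>) \<approx> (UNIV :: real set) \<and>
    differentially_compact_space (Phi UNIV \<A>) \<and> Phi UNIV \<A> \<notin> FinBW \<Lambda> \<I>"
proof -
  have small: "\<exists>D. infinite D \<and> \<phi> ` Delta D \<in> \<I>" if "range \<phi> \<subseteq> \<Lambda>" for \<phi>
    using that by (intro assms(5)) auto
  have dR: "diagonally_Ramsey Delta"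
    using diagonally_Ramsey_image[OF diagonally_Ramsey_ordered_pairs, of "\<lambda>(a, b). b - a"]
    by (simp add: Delta_eq_image[abs_def])
  obtain \<A> :: "nat set set" where "almost_disjoint_family UNIV \<A>" "infinite \<A>"
    "Hausdorff_space (Phi UNIV \<A>)" "compact_space (Phi UNIV \<A>)" "separable_space (Phi UNIV \<A>)"
    "topspace (Phi UNIV \<A>) \<approx> (UNIV :: real set)" "Phi UNIV \<A> \<notin> FinBW \<Lambda> \<I>"
    "\<forall>f. f \<in> UNIV \<rightarrow> topspace (Phi UNIV \<A>) \<longrightarrow> (\<exists>D x. infinite D \<and> x \<in> topspace (Phi UNIV \<A>) \<and>
       (\<forall>U. openin (Phi UNIV \<A>) U \<and> x \<in> U \<longrightarrow> (\<exists>K. finite K \<and> f ` Delta (D - K) \<subseteq> U)))"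
    by (rule Phi_space_exists[OF assms(1-4) dR infinite_Delta small])
  then show ?thesis unfolding differentially_compact_space_def by (intro exI[of _ \<A>]) simp
qed

text \<open>\<open>Phi_space_exists\<close> expects sets of numbers, so an enumeration of the
  unordered pairs translates between pairs and their codes.\<close>

lemma Ramsey_space_exists:
  fixes \<Lambda> :: "'a set"
  assumes "continuum_hypothesis" "countable \<Lambda>" "infinite \<Lambda>" "ideal_on \<Lambda> \<I>"
    and "\<And>\<phi>. \<phi> \<in> [UNIV :: nat set]\<^bsup>2\<^esup> \<rightarrow> \<Lambda> \<Longrightarrow> \<exists>D. infinite D \<and> \<phi> ` [D]\<^bsup>2\<^esup> \<in> \<I>"
  shows "\<exists>\<A> :: nat set set. almost_disjoint_family UNIV \<A> \<and> infinite \<A> \<and>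
    Hausdorff_space (Phi UNIV \<A>) \<and> compact_space (Phi UNIV \<A>) \<and>
    separable_space (Phi UNIV \<A>) \<and> topspace (Phi UNIV \<A>) \<approx> (UNIV :: real set) \<and>
    Ramsey_space (Phi UNIV \<A>) \<and> Phi UNIV \<A> \<notin> FinBW \<Lambda> \<I>"
proof -
  define P where "P = [UNIV :: nat set]\<^bsup>2\<^esup>"
  have "P = (\<lambda>(a, b). {a, b}) ` ordered_pairs UNIV" by (simp add: P_def nsets_2_eq_image)
  then have P: "countable P" by simp
  have infP: "infinite P" unfolding P_def by (rule infinite_imp_infinite_nsets) auto
  define code where "code = to_nat_on P"
  define decode where "decode = from_nat_into P"
  have decode: "decode n \<in> P" for n
    unfolding decode_def by (rule from_nat_into) (use infP in auto)
  have dc: "decode (code e) = e" if "e \<in> P" for e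
    unfolding decode_def code_def using P that by simp
  have DP: "[D]\<^bsup>2\<^esup> \<subseteq> P" for D unfolding P_def by (rule nsets_mono) simp
  define \<rho> where "\<rho> D = code ` [D]\<^bsup>2\<^esup>" for D
  have decode_\<rho>: "decode ` \<rho> D = [D]\<^bsup>2\<^esup>" for D
  proof -
    have "decode ` \<rho> D = (\<lambda>e. decode (code e)) ` [D]\<^bsup>2\<^esup>" by (simp add: \<rho>_def image_image)
    also have "\<dots> = (\<lambda>e. e) ` [D]\<^bsup>2\<^esup>" using dc DP[of D] by (intro image_cong) auto
    finally show ?thesis by simp
  qed
  have "diagonally_Ramsey \<rho>"
    using diagonally_Ramsey_image[OF diagonally_Ramsey_ordered_pairs, of "\<lambda>p. code (case p of (a, b) \<Rightarrow> {a, b})"]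
    by (simp add: \<rho>_def[abs_def] nsets_2_eq_image image_image)
  moreover have "infinite (\<rho> D)" if "infinite D" for D
  proof -
    have "infinite ([D]\<^bsup>2\<^esup>)" using that by (intro infinite_imp_infinite_nsets) auto
    then show ?thesis using finite_imageI[of "\<rho> D" decode] decode_\<rho>[of D] by auto
  qed
  moreover have "\<exists>D. infinite D \<and> \<phi> ` \<rho> D \<in> \<I>" if "range \<phi> \<subseteq> \<Lambda>" for \<phi>
  proof -
    have "\<phi> \<circ> code \<in> [UNIV]\<^bsup>2\<^esup> \<rightarrow> \<Lambda>" using that by auto
    from assms(5)[OF this] show ?thesis by (simp add: \<rho>_def image_comp)
  qed
  ultimately obtain \<A> :: "nat set set" where A: "almost_disjoint_family UNIV \<A>" "infinite \<A>"
    "Hausdorff_space (Phi UNIV \<A>)" "compact_space (Phi UNIV \<A>)" "separable_space (Phi UNIV \<A>)"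
    "topspace (Phi UNIV \<A>) \<approx> (UNIV :: real set)" "Phi UNIV \<A> \<notin> FinBW \<Lambda> \<I>"
    and conv: "\<forall>f. f \<in> UNIV \<rightarrow> topspace (Phi UNIV \<A>) \<longrightarrow> (\<exists>D x. infinite D \<and> x \<in> topspace (Phi UNIV \<A>) \<and>
       (\<forall>U. openin (Phi UNIV \<A>) U \<and> x \<in> U \<longrightarrow> (\<exists>K. finite K \<and> f ` \<rho> (D - K) \<subseteq> U)))"
    by (rule Phi_space_exists[OF assms(1-4)])
  have "Ramsey_space (Phi UNIV \<A>)"
    unfolding Ramsey_space_def
  proof (intro allI impI)
    fix f :: "nat set \<Rightarrow> (nat + nat set) option" assume "f \<in> [UNIV]\<^bsup>2\<^esup> \<rightarrow> topspace (Phi UNIV \<A>)"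
    \<comment> \<open>\<open>f\<close> is controlled on pairs only, but \<open>decode\<close>
      returns a pair for every number, so the composite is an admissible test map.\<close>
    then have "f \<circ> decode \<in> UNIV \<rightarrow> topspace (Phi UNIV \<A>)" using decode by (auto simp: P_def)
    from conv[THEN spec, THEN mp, OF this] show "\<exists>D x. infinite D \<and> x \<in> topspace (Phi UNIV \<A>) \<and>
        (\<forall>U. openin (Phi UNIV \<A>) U \<and> x \<in> U \<longrightarrow> (\<exists>K. finite K \<and> f ` [D - K]\<^bsup>2\<^esup> \<subseteq> U))"
      by (simp only: image_comp[symmetric] decode_\<rho>)
  qed
  then show ?thesis using A by (intro exI[of _ \<A>]) simp
qed

theorem corollary14p10:
  assumes "continuum_hypothesis"
  shows "(\<forall>(\<Lambda> :: 'a set) \<I>. countable \<Lambda> \<and> infinite \<Lambda> \<and> ideal_on \<Lambda> \<I> \<longrightarrow>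
        (\<not> katetov_le \<Lambda> \<I> UNIV Hindman_ideal \<longrightarrow>
         (\<exists>\<A> :: nat set set. almost_disjoint_family UNIV \<A> \<and> infinite \<A> \<and>
            Hausdorff_space (Phi UNIV \<A>) \<and> compact_space (Phi UNIV \<A>) \<and>
            separable_space (Phi UNIV \<A>) \<and> topspace (Phi UNIV \<A>) \<approx> (UNIV :: real set) \<and>
            Hindman_space (Phi UNIV \<A>) \<and> Phi UNIV \<A> \<notin> FinBW \<Lambda> \<I>)) \<and>
        (\<not> katetov_le \<Lambda> \<I> ([UNIV]\<^bsup>2\<^esup>) Ramsey_ideal \<longrightarrow>
         (\<exists>\<A> :: nat set set. almost_disjoint_family UNIV \<A> \<and> infinite \<A> \<and>
            Hausdorff_space (Phi UNIV \<A>) \<and> compact_space (Phi UNIV \<A>) \<and>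
            separable_space (Phi UNIV \<A>) \<and> topspace (Phi UNIV \<A>) \<approx> (UNIV :: real set) \<and>
            Ramsey_space (Phi UNIV \<A>) \<and> Phi UNIV \<A> \<notin> FinBW \<Lambda> \<I>)) \<and>
        (\<not> katetov_le \<Lambda> \<I> UNIV Delta_ideal \<longrightarrow>
         (\<exists>\<A> :: nat set set. almost_disjoint_family UNIV \<A> \<and> infinite \<A> \<and>
            Hausdorff_space (Phi UNIV \<A>) \<and> compact_space (Phi UNIV \<A>) \<and>
            separable_space (Phi UNIV \<A>) \<and> topspace (Phi UNIV \<A>) \<approx> (UNIV :: real set) \<and>
            differentially_compact_space (Phi UNIV \<A>) \<and> Phi UNIV \<A> \<notin> FinBW \<Lambda> \<I>))) \<and>
     (\<exists>\<A> :: nat set set. almost_disjoint_family UNIV \<A> \<and> infinite \<A> \<and>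
        Hausdorff_space (Phi UNIV \<A>) \<and> compact_space (Phi UNIV \<A>) \<and>
        separable_space (Phi UNIV \<A>) \<and> topspace (Phi UNIV \<A>) \<approx> (UNIV :: real set) \<and>
        Hindman_space (Phi UNIV \<A>) \<and> Phi UNIV \<A> \<notin> FinBW UNIV summable_ideal) \<and>
     (\<exists>\<A> :: nat set set. almost_disjoint_family UNIV \<A> \<and> infinite \<A> \<and>
        Hausdorff_space (Phi UNIV \<A>) \<and> compact_space (Phi UNIV \<A>) \<and>
        separable_space (Phi UNIV \<A>) \<and> topspace (Phi UNIV \<A>) \<approx> (UNIV :: real set) \<and>
        Ramsey_space (Phi UNIV \<A>) \<and> Phi UNIV \<A> \<notin> FinBW UNIV summable_ideal) \<and>
     (\<exists>\<A> :: nat set set. almost_disjoint_family UNIV \<A> \<and> infinite \<A> \<and>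
        Hausdorff_space (Phi UNIV \<A>) \<and> compact_space (Phi UNIV \<A>) \<and>
        separable_space (Phi UNIV \<A>) \<and> topspace (Phi UNIV \<A>) \<approx> (UNIV :: real set) \<and>
        differentially_compact_space (Phi UNIV \<A>) \<and> Phi UNIV \<A> \<notin> FinBW UNIV summable_ideal)"
proof (intro conjI allI impI)
  fix \<Lambda> :: "'a set" and \<I>
  assume L: "countable \<Lambda> \<and> infinite \<Lambda> \<and> ideal_on \<Lambda> \<I>"
  then have L1: "countable \<Lambda>" and L2: "infinite \<Lambda>" and L3: "ideal_on \<Lambda> \<I>" by blast+
  {
    assume "\<not> katetov_le \<Lambda> \<I> UNIV Hindman_ideal"
    then show "\<exists>\<A> :: nat set set. almost_disjoint_family UNIV \<A> \<and> infinite \<A> \<and>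
            Hausdorff_space (Phi UNIV \<A>) \<and> compact_space (Phi UNIV \<A>) \<and>
            separable_space (Phi UNIV \<A>) \<and> topspace (Phi UNIV \<A>) \<approx> (UNIV :: real set) \<and>
            Hindman_space (Phi UNIV \<A>) \<and> Phi UNIV \<A> \<notin> FinBW \<Lambda> \<I>"
      unfolding Hindman_ideal_eq
      by (intro Hindman_space_exists[OF assms L1 L2 L3] not_katetov_le_small_image[OF _ L3])
  next
    assume "\<not> katetov_le \<Lambda> \<I> ([UNIV]\<^bsup>2\<^esup>) Ramsey_ideal"
    then show "\<exists>\<A> :: nat set set. almost_disjoint_family UNIV \<A> \<and> infinite \<A> \<and>
            Hausdorff_space (Phi UNIV \<A>) \<and> compact_space (Phi UNIV \<A>) \<and>
            separable_space (Phi UNIV \<A>) \<and> topspace (Phi UNIV \<A>) \<approx> (UNIV :: real set) \<and>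
            Ramsey_space (Phi UNIV \<A>) \<and> Phi UNIV \<A> \<notin> FinBW \<Lambda> \<I>"
      unfolding Ramsey_ideal_def
      by (intro Ramsey_space_exists[OF assms L1 L2 L3] not_katetov_le_small_image[OF _ L3])
  next
    assume "\<not> katetov_le \<Lambda> \<I> UNIV Delta_ideal"
    then show "\<exists>\<A> :: nat set set. almost_disjoint_family UNIV \<A> \<and> infinite \<A> \<and>
            Hausdorff_space (Phi UNIV \<A>) \<and> compact_space (Phi UNIV \<A>) \<and>
            separable_space (Phi UNIV \<A>) \<and> topspace (Phi UNIV \<A>) \<approx> (UNIV :: real set) \<and>
            differentially_compact_space (Phi UNIV \<A>) \<and> Phi UNIV \<A> \<notin> FinBW \<Lambda> \<I>"
      unfolding Delta_ideal_eq
      by (intro differentially_compact_space_exists[OF assms L1 L2 L3] not_katetov_le_small_image[OF _ L3])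
  }
next
  show "\<exists>\<A> :: nat set set. almost_disjoint_family UNIV \<A> \<and> infinite \<A> \<and>
        Hausdorff_space (Phi UNIV \<A>) \<and> compact_space (Phi UNIV \<A>) \<and>
        separable_space (Phi UNIV \<A>) \<and> topspace (Phi UNIV \<A>) \<approx> (UNIV :: real set) \<and>
        Hindman_space (Phi UNIV \<A>) \<and> Phi UNIV \<A> \<notin> FinBW UNIV summable_ideal"
    by (intro Hindman_space_exists[OF assms _ _ ideal_on_summable_ideal] FS_summable) auto
next
  \<comment> \<open>The value at an increasing pair is taken to be \<open>\<phi> {a, b}\<close> here
    and \<open>\<phi> (b - a)\<close> in the last case, so \<open>ordered_pairs_summable\<close>
    settles both.\<close>
  have "\<exists>D. infinite D \<and> \<phi> ` [D]\<^bsup>2\<^esup> \<in> summable_ideal" for \<phi> :: "nat set \<Rightarrow> nat"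
    using ordered_pairs_summable[of "\<lambda>a b. \<phi> {a, b}"]
    by (simp add: nsets_2_eq_image image_image case_prod_beta)
  then show "\<exists>\<A> :: nat set set. almost_disjoint_family UNIV \<A> \<and> infinite \<A> \<and>
        Hausdorff_space (Phi UNIV \<A>) \<and> compact_space (Phi UNIV \<A>) \<and>
        separable_space (Phi UNIV \<A>) \<and> topspace (Phi UNIV \<A>) \<approx> (UNIV :: real set) \<and>
        Ramsey_space (Phi UNIV \<A>) \<and> Phi UNIV \<A> \<notin> FinBW UNIV summable_ideal"
    by (intro Ramsey_space_exists[OF assms _ _ ideal_on_summable_ideal]) auto
next
  have "\<exists>D. infinite D \<and> \<phi> ` Delta D \<in> summable_ideal" for \<phi> :: "nat \<Rightarrow> nat"
    using ordered_pairs_summable[of "\<lambda>a b. \<phi> (b - a)"]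
    by (simp add: Delta_eq_image image_image case_prod_beta)
  then show "\<exists>\<A> :: nat set set. almost_disjoint_family UNIV \<A> \<and> infinite \<A> \<and>
        Hausdorff_space (Phi UNIV \<A>) \<and> compact_space (Phi UNIV \<A>) \<and>
        separable_space (Phi UNIV \<A>) \<and> topspace (Phi UNIV \<A>) \<approx> (UNIV :: real set) \<and>
        differentially_compact_space (Phi UNIV \<A>) \<and> Phi UNIV \<A> \<notin> FinBW UNIV summable_ideal"
    by (intro differentially_compact_space_exists[OF assms _ _ ideal_on_summable_ideal]) auto
qed

end
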